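(* For a sequence (indexed by $n\in\mathbb N$) of irreducible reversible transitive Markov chains on finite state spaces, where a superscript $(n)$ denotes the quantity for the $n$th chain, $$t_{\mathrm{rel}}^{(n)}\ll t_{\mathrm I}^{(n)}\quad\text{if and only if}\quad\big(t_{\mathrm{mix}}^{(\infty)}\big)^{(n)}\ll t_{\mathrm I}^{(n)} .$$
   Context: For an irreducible transition matrix $P$ on a finite state space $V$ ($|V|\ge2$), reversible with respect to its stationary distribution $\pi$, consider the continuous-time rate 1 chain with heat kernel $H_t:=e^{-t(I-P)}$. The eigenvalues of $I-P$ are $0=\lambda_1<\lambda_2\le\cdots\le\lambda_{|V|}\le2$ and $t_{\mathrm{rel}}:=1/\lambda_2$. $P$ is transitive if for all $x,y\in V$ there is a bijection $f:V\to V$ with $f(x)=y$ and $P(w,z)=P(f(w),f(z))$ for all $w,z\in V$. $t_{\mathrm{mix}}^{(\infty)}:=\inf\{t\ge0:\max_{a,b\in V}|H_t(a,b)/\pi(b)-1|\le1/2\}$. Let $(X_t)_{t\ge0}$ and $(Y_t)_{t\ge0}$ be two independent realizations of the rate 1 continuous-time chain. The intersection time is $\tau_I:=\inf\{t\ge0:X_t\in\{Y_s:s\in[0,t]\}\text{ or }Y_t\in\{X_s:s\in[0,t]\}\}$, and $t_{\mathrm I}:=\max_{x,y\in V}\mathbb E_{x,y}[\tau_I]$, where $\mathbb E_{x,y}[\cdot]:=\mathbb E[\,\cdot\mid X_0=x,Y_0=y]$. $f_n\ll g_n$ means $f_n/g_n\to0$ as $n\to\infty$. *)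

theory Defs
  imports "HOL-Probability.Probability"
begin

section \<open>Markov chains on a finite set\<close>

text \<open>
  A chain on the finite set \<open>V\<close> is given by a kernel \<open>P\<close>; the entry \<open>P(x,y)\<close> of its transition
  matrix is \<open>pmf (P x) y\<close>. Values of \<open>P\<close> outside \<open>V\<close> are irrelevant.
\<close>

definition transition_kernel :: "'a set \<Rightarrow> ('a \<Rightarrow> 'a pmf) \<Rightarrow> bool" where
  "transition_kernel V P \<longleftrightarrow> (\<forall>x\<in>V. set_pmf (P x) \<subseteq> V)"

definition trans_mat :: "('a \<Rightarrow> 'a pmf) \<Rightarrow> 'a \<Rightarrow> 'a \<Rightarrow> real" where
  "trans_mat P x y = pmf (P x) y"

definition id_mat :: "'a \<Rightarrow> 'a \<Rightarrow> real" where
  "id_mat x y = (if x = y then 1 else 0)"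

primrec mat_power :: "'a set \<Rightarrow> ('a \<Rightarrow> 'a \<Rightarrow> real) \<Rightarrow> nat \<Rightarrow> 'a \<Rightarrow> 'a \<Rightarrow> real" where
  "mat_power V A 0 = id_mat"
| "mat_power V A (Suc k) = (\<lambda>x y. \<Sum>z\<in>V. A x z * mat_power V A k z y)"

definition mat_exp :: "'a set \<Rightarrow> ('a \<Rightarrow> 'a \<Rightarrow> real) \<Rightarrow> 'a \<Rightarrow> 'a \<Rightarrow> real" where
  "mat_exp V A x y = (\<Sum>k. mat_power V A k x y / fact k)"

definition laplacian :: "('a \<Rightarrow> 'a pmf) \<Rightarrow> 'a \<Rightarrow> 'a \<Rightarrow> real" where
  "laplacian P x y = id_mat x y - trans_mat P x y"

definition irreducible_chain :: "'a set \<Rightarrow> ('a \<Rightarrow> 'a pmf) \<Rightarrow> bool" where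
  "irreducible_chain V P \<longleftrightarrow> (\<forall>x\<in>V. \<forall>y\<in>V. \<exists>k. mat_power V (trans_mat P) k x y > 0)"

definition stationary_distribution :: "'a set \<Rightarrow> ('a \<Rightarrow> 'a pmf) \<Rightarrow> 'a pmf \<Rightarrow> bool" where
  "stationary_distribution V P \<pi> \<longleftrightarrow> set_pmf \<pi> \<subseteq> V \<and> bind_pmf \<pi> P = \<pi>"

definition reversible_chain :: "'a set \<Rightarrow> ('a \<Rightarrow> 'a pmf) \<Rightarrow> 'a pmf \<Rightarrow> bool" where
  "reversible_chain V P \<pi> \<longleftrightarrow>
     (\<forall>x\<in>V. \<forall>y\<in>V. pmf \<pi> x * trans_mat P x y = pmf \<pi> y * trans_mat P y x)"

definition transitive_chain :: "'a set \<Rightarrow> ('a \<Rightarrow> 'a pmf) \<Rightarrow> bool" where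
  "transitive_chain V P \<longleftrightarrow>
     (\<forall>x\<in>V. \<forall>y\<in>V. \<exists>f. bij_betw f V V \<and> f x = y \<and>
        (\<forall>w\<in>V. \<forall>z\<in>V. trans_mat P w z = trans_mat P (f w) (f z)))"


section \<open>Relaxation time and \<open>L\<^sup>\<infinity>\<close> mixing time\<close>

definition heat_kernel :: "'a set \<Rightarrow> ('a \<Rightarrow> 'a pmf) \<Rightarrow> real \<Rightarrow> 'a \<Rightarrow> 'a \<Rightarrow> real" where
  "heat_kernel V P t = mat_exp V (\<lambda>x y. - t * laplacian P x y)"

definition mat_eigenvalue :: "'a set \<Rightarrow> ('a \<Rightarrow> 'a \<Rightarrow> real) \<Rightarrow> real \<Rightarrow> bool" where
  "mat_eigenvalue V A c \<longleftrightarrow>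
     (\<exists>f. (\<exists>x\<in>V. f x \<noteq> 0) \<and> (\<forall>x\<in>V. (\<Sum>y\<in>V. A x y * f y) = c * f x))"

text \<open>
  For an irreducible reversible chain with at least two states, all eigenvalues of \<open>I - P\<close> are
  real and \<open>0\<close> is a simple eigenvalue, so in the ordering
  \<open>0 = \<lambda>\<^sub>1 < \<lambda>\<^sub>2 \<le> \<dots>\<close> the value \<open>\<lambda>\<^sub>2\<close> is the smallest eigenvalue other than \<open>0\<close>.
\<close>

definition lambda2 :: "'a set \<Rightarrow> ('a \<Rightarrow> 'a pmf) \<Rightarrow> real" where
  "lambda2 V P = Min {c. mat_eigenvalue V (laplacian P) c \<and> c \<noteq> 0}"

definition t_rel :: "'a set \<Rightarrow> ('a \<Rightarrow> 'a pmf) \<Rightarrow> real" where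
  "t_rel V P = 1 / lambda2 V P"

definition t_mix_inf :: "'a set \<Rightarrow> ('a \<Rightarrow> 'a pmf) \<Rightarrow> 'a pmf \<Rightarrow> real" where
  "t_mix_inf V P \<pi> =
     Inf {t. 0 \<le> t \<and>
       Max ((\<lambda>(a, b). \<bar>heat_kernel V P t a b / pmf \<pi> b - 1\<bar>) ` (V \<times> V)) \<le> 1 / 2}"


section \<open>The continuous-time chain and the intersection time\<close>

text \<open>
  The rate 1 continuous-time chain is realised from an i.i.d. sequence of pairs
  \<open>(F\<^sub>k, \<xi>\<^sub>k)\<close>: \<open>F\<^sub>k\<close> is a random map with independent values \<open>F\<^sub>k(x) \<sim> P(x,\<cdot>)\<close>, \<open>x \<in> V\<close>, and
  \<open>\<xi>\<^sub>k\<close> is an independent exponential variable of rate 1. The \<open>k\<close>-th visited state \<open>z\<close> is held for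
  time \<open>\<xi>\<^sub>k\<close>, after which the chain moves to \<open>F\<^sub>k(z)\<close>; only the one value \<open>F\<^sub>k(z)\<close> is used, so
  the jumps form a Markov chain with transition matrix \<open>P\<close>.
\<close>

definition driving_measure ::
  "'a set \<Rightarrow> ('a \<Rightarrow> 'a pmf) \<Rightarrow> (('a \<Rightarrow> 'a) \<times> real) stream measure" where
  "driving_measure V P =
     stream_space (measure_pmf (Pi_pmf V undefined P) \<Otimes>\<^sub>M
       density lborel (\<lambda>s. ennreal (exponential_density 1 s)))"

primrec jump_chain :: "'a \<Rightarrow> (('a \<Rightarrow> 'a) \<times> real) stream \<Rightarrow> nat \<Rightarrow> 'a" where
  "jump_chain x \<omega> 0 = x"
| "jump_chain x \<omega> (Suc k) = fst (\<omega> !! k) (jump_chain x \<omega> k)"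

definition jump_time :: "(('a \<Rightarrow> 'a) \<times> real) stream \<Rightarrow> nat \<Rightarrow> real" where
  "jump_time \<omega> k = (\<Sum>i<k. snd (\<omega> !! i))"

text \<open>
  The \<open>LEAST\<close> is the number of jumps up to time \<open>t\<close>; it exists for all \<open>t\<close> almost surely.
\<close>

definition ct_chain :: "'a \<Rightarrow> (('a \<Rightarrow> 'a) \<times> real) stream \<Rightarrow> real \<Rightarrow> 'a" where
  "ct_chain x \<omega> t = jump_chain x \<omega> (LEAST k. t < jump_time \<omega> (Suc k))"

text \<open>
  Valued in \<open>ennreal\<close>, so that the infimum of the empty set is \<open>\<infinity>\<close>.
\<close>

definition intersection_time :: "(real \<Rightarrow> 'a) \<Rightarrow> (real \<Rightarrow> 'a) \<Rightarrow> ennreal" where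
  "intersection_time X Y =
     Inf {ennreal t | t. 0 \<le> t \<and> (X t \<in> Y ` {0..t} \<or> Y t \<in> X ` {0..t})}"

definition expected_intersection_time ::
  "'a set \<Rightarrow> ('a \<Rightarrow> 'a pmf) \<Rightarrow> 'a \<Rightarrow> 'a \<Rightarrow> ennreal" where
  "expected_intersection_time V P x y =
     (\<integral>\<^sup>+ \<omega>. intersection_time (ct_chain x (fst \<omega>)) (ct_chain y (snd \<omega>))
        \<partial>(driving_measure V P \<Otimes>\<^sub>M driving_measure V P))"

definition t_I :: "'a set \<Rightarrow> ('a \<Rightarrow> 'a pmf) \<Rightarrow> ennreal" where
  "t_I V P = Max ((\<lambda>(x, y). expected_intersection_time V P x y) ` (V \<times> V))"

text \<open>
  The relation \<open>f\<^sub>n \<lless> g\<^sub>n\<close>. Used only with \<open>g\<^sub>n = t\<^sub>I\<close>, which lies in \<open>(0, \<infinity>)\<close>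
  for an irreducible chain with at least two states.
\<close>

definition much_less :: "(nat \<Rightarrow> ennreal) \<Rightarrow> (nat \<Rightarrow> ennreal) \<Rightarrow> bool" where
  "much_less f g \<longleftrightarrow> (\<lambda>n. f n / g n) \<longlonglongrightarrow> 0"

end

theory Submission
  imports Defs
begin

text \<open>
  Let \<open>\<lambda>\<^sub>j\<close> be the eigenvalues of \<open>I - P\<close> and \<open>Q = \<Sum>\<^sub>j 1/\<lambda>\<^sub>j\<^sup>2\<close>, summed over \<open>\<lambda>\<^sub>j \<noteq> 0\<close>.
  Testing the heat kernel on an eigenfunction for \<open>\<lambda>\<^sub>2\<close> gives \<open>t\<^sub>r\<^sub>e\<^sub>l \<le> 2 t\<^sub>m\<^sub>i\<^sub>x\<close>, which is one direction.
  For the other, transitivity bounds the \<open>L\<^sup>\<infinity>\<close> distance at time \<open>t\<close> by \<open>\<Sum>\<^sub>j exp (- t \<lambda>\<^sub>j)\<close>, and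
  \<open>exp (- x) \<le> 256 / x\<^sup>4\<close> turns this into \<open>t\<^sub>m\<^sub>i\<^sub>x\<^sup>2 \<le> 25 t\<^sub>r\<^sub>e\<^sub>l \<surd>Q\<close>. It remains to show
  \<open>\<surd>Q \<le> C (t\<^sub>r\<^sub>e\<^sub>l + t\<^sub>I)\<close>, for then \<open>t\<^sub>m\<^sub>i\<^sub>x\<^sup>2 \<le> 25 C t\<^sub>r\<^sub>e\<^sub>l (t\<^sub>r\<^sub>e\<^sub>l + t\<^sub>I)\<close>. With \<open>g = \<Sum>\<^sub>i\<^sub>\<le>\<^sub>m P\<^sup>i\<close> and
  \<open>S = \<Sum>\<^sub>y g(x,y)\<^sup>2\<close>, a second-moment argument shows that two jump chains meet within \<open>m\<close> steps with
  probability at most \<open>O(m\<^sup>2 / (|V| S))\<close>, while \<open>|V| S = tr g\<^sup>2 \<ge> Q/4\<close> as soon as \<open>m\<close> is even and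
  \<open>m + 1 \<ge> t\<^sub>r\<^sub>e\<^sub>l\<close>. Taking \<open>m\<close> to be a small multiple of \<open>\<surd>Q\<close> gives the claim.
\<close>

section \<open>Spectral theorem for symmetric matrices\<close>

text \<open>Only lower bounds on \<open>t_I\<close> are used, so it suffices to exhibit events on
  which no intersection can have happened. The meeting estimate controls only an average over the
  starting point of one walk; since \<open>t_I\<close> is a maximum over starting points, an average
  is enough. The power four in \<open>exp (- x) \<le> 256 / x^4\<close> is chosen to meet
  \<open>Q\<close>: of the four factors \<open>1/\<lambda>_j\<close> two build \<open>Q\<close>, and
  the other two are bounded by \<open>t_rel\<close>. Two demands on \<open>m\<close> compete:
  \<open>m + 1 \<ge> t_rel\<close>, so that the truncated Green function sees every nonzero
  eigenvalue at full strength up to a factor, and \<open>m\<close> at most a small multiple of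
  \<open>\<surd>Q\<close>, so that meeting is unlikely. They conflict only if
  \<open>\<surd>Q\<close> is at most a constant times \<open>t_rel\<close>, and then the claim is
  immediate. This is why \<open>t_rel\<close> stands beside \<open>t_I\<close> in the bound on
  \<open>\<surd>Q\<close>. With \<open>\<rho> = t_rel / t_I\<close> the final estimate reads
  \<open>(t_mix / t_I)^2 \<le> C' \<rho> (\<rho> + 1)\<close>. The factor \<open>\<rho>\<close> in
  front is what makes the left side vanish with \<open>\<rho>\<close>.\<close>

definition inner_on :: "'a set \<Rightarrow> ('a \<Rightarrow> real) \<Rightarrow> ('a \<Rightarrow> real) \<Rightarrow> real" where
  "inner_on V f g = (\<Sum>x\<in>V. f x * g x)"

definition mat_vec :: "'a set \<Rightarrow> ('a \<Rightarrow> 'a \<Rightarrow> real) \<Rightarrow> ('a \<Rightarrow> real) \<Rightarrow> 'a \<Rightarrow> real" where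
  "mat_vec V A f x = (\<Sum>y\<in>V. A x y * f y)"

lemma inner_on_commute: "inner_on V f g = inner_on V g f"
  by (simp add: inner_on_def mult.commute)

lemma inner_on_add: "inner_on V (\<lambda>x. f x + g x) h = inner_on V f h + inner_on V g h"
  by (simp add: inner_on_def distrib_right sum.distrib)

lemma inner_on_diff: "inner_on V (\<lambda>x. f x - g x) h = inner_on V f h - inner_on V g h"
  by (simp add: inner_on_def left_diff_distrib sum_subtractf)

lemma inner_on_scale: "inner_on V (\<lambda>x. c * f x) h = c * inner_on V f h"
  by (simp add: inner_on_def sum_distrib_left mult.assoc)

lemma inner_on_cong:
  "(\<And>x. x \<in> V \<Longrightarrow> f x = f' x) \<Longrightarrow> (\<And>x. x \<in> V \<Longrightarrow> g x = g' x) \<Longrightarrow>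
    inner_on V f g = inner_on V f' g'"
  by (simp add: inner_on_def)

lemma inner_on_sum: "inner_on V (\<lambda>x. \<Sum>i\<in>I. f i x) h = (\<Sum>i\<in>I. inner_on V (f i) h)"
  by (simp add: inner_on_def sum_distrib_right sum.swap[of _ V])

lemma inner_on_self_nonneg: "inner_on V f f \<ge> 0"
  by (simp add: inner_on_def sum_nonneg)

lemma inner_on_self_eq_0: "finite V \<Longrightarrow> inner_on V f f = 0 \<longleftrightarrow> (\<forall>x\<in>V. f x = 0)"
  by (simp add: inner_on_def sum_nonneg_eq_0_iff)

lemma inner_on_mat_vec_symmetric:
  assumes "\<And>x y. x \<in> V \<Longrightarrow> y \<in> V \<Longrightarrow> A x y = A y x"
  shows "inner_on V (mat_vec V A f) g = inner_on V f (mat_vec V A g)"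
proof -
  have "inner_on V (mat_vec V A f) g = (\<Sum>x\<in>V. \<Sum>y\<in>V. A x y * f y * g x)"
    by (simp add: inner_on_def mat_vec_def sum_distrib_right)
  also have "\<dots> = (\<Sum>y\<in>V. \<Sum>x\<in>V. A x y * f y * g x)"
    by (rule sum.swap)
  also have "\<dots> = (\<Sum>y\<in>V. \<Sum>x\<in>V. f y * (A y x * g x))"
    by (intro sum.cong refl) (simp add: assms)
  finally show ?thesis
    by (simp add: inner_on_def mat_vec_def sum_distrib_left)
qed

lemma continuous_on_coordinate: "continuous_on S (\<lambda>f::'a \<Rightarrow> real. f x)"
  by (rule continuous_on_subset[OF continuous_on_product_coordinates subset_UNIV])

text \<open>Functions live on all of \<open>'a\<close>, so the coordinates outside \<open>V\<close>
  are pinned to 0: the cube is then a product of compact sets and Tychonoff applies. It contains the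
  unit sphere of \<open>V\<close>, on which a maximiser is sought.\<close>

lemma compact_cube_on:
  "compact {f::'a \<Rightarrow> real. (\<forall>x\<in>V. \<bar>f x\<bar> \<le> 1) \<and> (\<forall>x. x \<notin> V \<longrightarrow> f x = 0)}"
proof -
  define S where "S x = (if x \<in> V then {-1..1} else {0::real})" for x
  have "compactin (product_topology (\<lambda>_::'a. euclideanreal) UNIV) (PiE UNIV S)"
    by (subst compactin_PiE) (auto simp: S_def)
  moreover have "PiE UNIV S = {f. (\<forall>x\<in>V. \<bar>f x\<bar> \<le> 1) \<and> (\<forall>x. x \<notin> V \<longrightarrow> f x = 0)}"
    by (auto simp: S_def PiE_def Pi_def abs_le_iff split: if_splits)
  ultimately show ?thesis
    by (simp add: euclidean_product_topology)
qed

text \<open>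
  A maximiser \<open>f\<close> of the Rayleigh quotient on the orthogonal complement is an eigenvector: moving
  from \<open>f\<close> in the direction \<open>Af - cf\<close> would otherwise increase the quotient.
\<close>

lemma eigenvector_in_complement:
  assumes fin: "finite V"
    and sym: "\<And>x y. x \<in> V \<Longrightarrow> y \<in> V \<Longrightarrow> A x y = A y x"
    and eig: "\<And>j x. j < k \<Longrightarrow> x \<in> V \<Longrightarrow> mat_vec V A (\<phi> j) x = lam j * \<phi> j x"
    and h0: "\<And>j. j < k \<Longrightarrow> inner_on V h0 (\<phi> j) = 0" "inner_on V h0 h0 \<noteq> 0"
  shows "\<exists>f c. (\<forall>j<k. inner_on V f (\<phi> j) = 0) \<and> inner_on V f f = 1 \<and>
    (\<forall>x\<in>V. mat_vec V A f x = c * f x)"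
proof -
  let ?ip = "inner_on V"
  let ?A = "mat_vec V A"
  define C where "C = {f::'a \<Rightarrow> real. (\<forall>x\<in>V. \<bar>f x\<bar> \<le> 1) \<and> (\<forall>x. x \<notin> V \<longrightarrow> f x = 0)}"
  define K where "K = C \<inter> ({f. ?ip f f = 1} \<inter> (\<Inter>j\<in>{..<k}. {f. ?ip f (\<phi> j) = 0}))"
  have "closed ({f. ?ip f f = 1} \<inter> (\<Inter>j\<in>{..<k}. {f. ?ip f (\<phi> j) = 0}))"
    unfolding inner_on_def
    by (intro closed_Int closed_INT ballI closed_Collect_eq continuous_intros continuous_on_coordinate)
  then have "compact K"
    unfolding K_def C_def by (intro compact_Int_closed compact_cube_on)
  define normalise where
    "normalise h x = (if x \<in> V then h x / sqrt (?ip h h) else 0)" for h :: "'a \<Rightarrow> real" and x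
  have normalise: "normalise h \<in> K" if "\<And>j. j < k \<Longrightarrow> ?ip h (\<phi> j) = 0" "?ip h h \<noteq> 0" for h
  proof -
    have pos: "?ip h h > 0"
      using that(2) inner_on_self_nonneg[of V h] by simp
    have ip: "?ip (normalise h) g = ?ip h g / sqrt (?ip h h)" for g
      by (simp add: inner_on_def normalise_def sum_divide_distrib)
    have "?ip (normalise h) (normalise h) = ?ip h h / sqrt (?ip h h) / sqrt (?ip h h)"
      by (subst ip, subst inner_on_commute, subst ip) simp
    then have 1: "?ip (normalise h) (normalise h) = 1"
      using pos by simp
    moreover have "\<bar>normalise h x\<bar> \<le> 1" if "x \<in> V" for x
    proof -
      have "(normalise h x)\<^sup>2 \<le> ?ip (normalise h) (normalise h)"
        using that fin by (auto simp: inner_on_def power2_eq_square intro!: member_le_sum)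
      then show ?thesis
        using 1 by (simp add: abs_square_le_1)
    qed
    ultimately show ?thesis
      using that(1) by (auto simp: K_def C_def ip) (simp add: normalise_def)
  qed
  have "K \<noteq> {}"
    using normalise[of h0] h0 by blast
  moreover have "continuous_on K (\<lambda>f. ?ip f (?A f))"
    unfolding inner_on_def mat_vec_def by (intro continuous_intros continuous_on_coordinate)
  ultimately obtain f where f: "f \<in> K" and max: "\<And>g. g \<in> K \<Longrightarrow> ?ip g (?A g) \<le> ?ip f (?A f)"
    using continuous_attains_sup[OF \<open>compact K\<close>] by metis
  define c where "c = ?ip f (?A f)"
  have fperp: "?ip f (\<phi> j) = 0" if "j < k" for j
    using f that by (auto simp: K_def)
  have f1: "?ip f f = 1"
    using f by (auto simp: K_def)
  have Rayleigh: "?ip g (?A g) \<le> c * ?ip g g" if "\<And>j. j < k \<Longrightarrow> ?ip g (\<phi> j) = 0" for g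
  proof (cases "?ip g g = 0")
    case True
    then have "\<forall>x\<in>V. g x = 0"
      using inner_on_self_eq_0[OF fin] by blast
    then show ?thesis
      by (simp add: inner_on_def)
  next
    case False
    then have pos: "?ip g g > 0"
      using inner_on_self_nonneg[of V g] by simp
    have Ag: "?A (normalise g) x = ?A g x / sqrt (?ip g g)" for x
      by (simp add: mat_vec_def normalise_def sum_divide_distrib)
    have "?ip (normalise g) (?A (normalise g)) = ?ip g (?A g) / (sqrt (?ip g g) * sqrt (?ip g g))"
      by (simp add: inner_on_def normalise_def Ag[unfolded inner_on_def] sum_divide_distrib
          del: real_sqrt_mult_self)
    also have "\<dots> = ?ip g (?A g) / ?ip g g"
      using pos by simp
    finally have "?ip g (?A g) / ?ip g g \<le> c"
      using max[OF normalise[OF that False]] by (simp add: c_def)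
    then show ?thesis
      using pos by (simp add: divide_le_eq)
  qed
  define h where "h = (\<lambda>x. ?A f x - c * f x)"
  have Afperp: "?ip (?A f) (\<phi> j) = 0" if "j < k" for j
  proof -
    have "?ip (?A f) (\<phi> j) = ?ip f (?A (\<phi> j))"
      by (rule inner_on_mat_vec_symmetric[OF sym])
    also have "\<dots> = ?ip f (\<lambda>x. lam j * \<phi> j x)"
      by (rule inner_on_cong) (auto simp: eig that)
    also have "\<dots> = 0"
      using fperp[OF that] by (simp add: inner_on_commute[of V f] inner_on_scale)
    finally show ?thesis .
  qed
  have hperp: "?ip h (\<phi> j) = 0" if "j < k" for j
    using Afperp[OF that] fperp[OF that] by (simp add: h_def inner_on_diff inner_on_scale)
  have hf: "?ip h f = 0"
    by (simp add: h_def inner_on_diff inner_on_scale f1 c_def inner_on_commute)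
  have hAf: "?ip h (?A f) = ?ip h h"
  proof -
    have "?ip h h = ?ip (?A f) h - c * ?ip f h"
      by (subst (1) h_def) (simp only: inner_on_diff inner_on_scale)
    then show ?thesis
      using hf by (simp add: inner_on_commute)
  qed
  define B where "B = c * ?ip h h - ?ip h (?A h)"
  have key: "2 * e * ?ip h h \<le> e\<^sup>2 * B" for e
  proof -
    let ?g = "\<lambda>x. f x + e * h x"
    have Ag: "?A ?g = (\<lambda>x. ?A f x + e * ?A h x)"
      by (rule ext) (simp add: mat_vec_def distrib_left sum.distrib sum_distrib_left mult.left_commute)
    have fAh: "?ip f (?A h) = ?ip h h"
      using hAf inner_on_mat_vec_symmetric[of V A f h, OF sym] by (simp add: inner_on_commute)
    have gAg: "?ip ?g (?A ?g) = c + 2 * e * ?ip h h + e\<^sup>2 * ?ip h (?A h)"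
    proof -
      have "?ip ?g (?A ?g) = ?ip (?A f) f + e * ?ip (?A h) f + e * (?ip (?A f) h + e * ?ip (?A h) h)"
        unfolding Ag inner_on_add inner_on_scale
        by (subst (1 2) inner_on_commute) (simp only: inner_on_add inner_on_scale)
      then show ?thesis
        using fAh hAf
        by (simp add: inner_on_commute[of V "?A f"] inner_on_commute[of V "?A h"] c_def
            power2_eq_square algebra_simps)
    qed
    have gg: "?ip ?g ?g = 1 + e\<^sup>2 * ?ip h h"
    proof -
      have "?ip ?g ?g = ?ip f f + e * ?ip h f + e * (?ip f h + e * ?ip h h)"
        unfolding inner_on_add inner_on_scale
        by (subst (1 2) inner_on_commute) (simp only: inner_on_add inner_on_scale)
      then show ?thesis
        using hf f1 inner_on_commute[of V f h] by (simp add: power2_eq_square)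
    qed
    have "?ip ?g (?A ?g) \<le> c * ?ip ?g ?g"
      by (rule Rayleigh) (simp add: inner_on_add inner_on_scale fperp hperp)
    then show ?thesis
      unfolding gAg gg B_def by (simp add: algebra_simps)
  qed
  have "?ip h h = 0"
  proof (rule ccontr)
    assume "?ip h h \<noteq> 0"
    then have pos: "?ip h h > 0"
      using inner_on_self_nonneg[of V h] by simp
    \<comment> \<open>Small enough that \<open>e * B\<close> cannot reach
      \<open>2 * ?ip h h\<close>; the summand 1 keeps the denominator positive when
      \<open>B = 0\<close>.\<close>
    define e where "e = ?ip h h / (\<bar>B\<bar> + 1)"
    have e: "e > 0"
      using pos by (simp add: e_def)
    have "2 * ?ip h h \<le> e * B"
      using key[of e] e by (simp add: power2_eq_square)
    also have "\<dots> \<le> e * (\<bar>B\<bar> + 1)"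
      using e by (intro mult_left_mono) auto
    also have "\<dots> = ?ip h h"
      by (simp add: e_def)
    finally show False
      using pos by simp
  qed
  then have "\<forall>x\<in>V. h x = 0"
    using inner_on_self_eq_0[OF fin] by blast
  then show ?thesis
    using f1 fperp by (auto simp: h_def)
qed

section \<open>Orthonormal systems and the eigenbasis\<close>

definition orthonormal_upto :: "'a set \<Rightarrow> nat \<Rightarrow> (nat \<Rightarrow> 'a \<Rightarrow> real) \<Rightarrow> bool" where
  "orthonormal_upto V k \<phi> \<longleftrightarrow>
     (\<forall>i<k. \<forall>j<k. inner_on V (\<phi> i) (\<phi> j) = (if i = j then 1 else 0))"

lemma sum_squares_orthonormal:
  assumes "orthonormal_upto V k \<phi>"
  shows "(\<Sum>x\<in>V. \<Sum>j<k. (\<phi> j x)\<^sup>2) = real k"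
proof -
  have "(\<Sum>x\<in>V. \<Sum>j<k. (\<phi> j x)\<^sup>2) = (\<Sum>j<k. inner_on V (\<phi> j) (\<phi> j))"
    unfolding inner_on_def power2_eq_square by (rule sum.swap)
  also have "\<dots> = real k"
    using assms by (simp add: orthonormal_upto_def)
  finally show ?thesis .
qed

text \<open>The component of the unit vector at \<open>x\<close> orthogonal to the first
  \<open>k\<close> vectors.\<close>

definition residual :: "nat \<Rightarrow> (nat \<Rightarrow> 'a \<Rightarrow> real) \<Rightarrow> 'a \<Rightarrow> 'a \<Rightarrow> real" where
  "residual k \<phi> x y = id_mat x y - (\<Sum>j<k. \<phi> j x * \<phi> j y)"

lemma residual_orthogonal:
  assumes "finite V" "x \<in> V" "orthonormal_upto V k \<phi>" "i < k"
  shows "inner_on V (residual k \<phi> x) (\<phi> i) = 0"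
proof -
  have "inner_on V (residual k \<phi> x) (\<phi> i) =
      inner_on V (id_mat x) (\<phi> i) - (\<Sum>j<k. \<phi> j x * inner_on V (\<phi> j) (\<phi> i))"
    unfolding residual_def inner_on_diff inner_on_sum inner_on_scale ..
  also have "inner_on V (id_mat x) (\<phi> i) = \<phi> i x"
    using assms by (simp add: inner_on_def id_mat_def if_distrib[of "\<lambda>u. u * _"] cong: if_cong)
  also have "(\<Sum>j<k. \<phi> j x * inner_on V (\<phi> j) (\<phi> i)) = (\<Sum>j<k. if j = i then \<phi> i x else 0)"
    using assms by (intro sum.cong) (auto simp: orthonormal_upto_def)
  finally show ?thesis
    using assms by simp
qed

lemma inner_residual:
  assumes "finite V" "x \<in> V" "orthonormal_upto V k \<phi>"
  shows "inner_on V (residual k \<phi> x) (residual k \<phi> x) = 1 - (\<Sum>j<k. (\<phi> j x)\<^sup>2)"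
proof -
  let ?r = "residual k \<phi> x"
  have "inner_on V ?r ?r = inner_on V (id_mat x) ?r - (\<Sum>j<k. \<phi> j x * inner_on V (\<phi> j) ?r)"
    by (subst (1) residual_def[abs_def]) (simp only: inner_on_diff inner_on_sum inner_on_scale)
  also have "\<dots> = ?r x"
    using assms residual_orthogonal[OF assms]
    by (simp add: inner_on_commute[of V "\<phi> _"])
      (simp add: inner_on_def id_mat_def if_distrib[of "\<lambda>u. u * _"] cong: if_cong)
  finally show ?thesis
    by (simp add: residual_def id_mat_def power2_eq_square)
qed

text \<open>Induction on the number of vectors. The squared norms of the residuals add up to
  \<open>card V - k\<close>. While this is positive, some residual shows that the orthogonal
  complement is nontrivial and yields the next vector; at \<open>k = card V\<close> all residuals
  vanish, which is the completeness relation.\<close>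

theorem orthonormal_eigenbasis:
  assumes fin: "finite V"
    and sym: "\<And>x y. x \<in> V \<Longrightarrow> y \<in> V \<Longrightarrow> A x y = A y x"
    and u: "inner_on V u u = 1" "\<And>x. x \<in> V \<Longrightarrow> mat_vec V A u x = c * u x"
  obtains \<phi> lam where "\<phi> 0 = u" "lam 0 = c" "orthonormal_upto V (card V) \<phi>"
    "\<And>j x. j < card V \<Longrightarrow> x \<in> V \<Longrightarrow> mat_vec V A (\<phi> j) x = lam j * \<phi> j x"
    "\<And>x y. x \<in> V \<Longrightarrow> y \<in> V \<Longrightarrow> (\<Sum>j<card V. \<phi> j x * \<phi> j y) = id_mat x y"
proof -
  have ex: "k \<le> card V \<Longrightarrow> \<exists>\<phi> lam. \<phi> 0 = u \<and> lam 0 = c \<and> orthonormal_upto V k \<phi> \<and>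
    (\<forall>j<k. \<forall>x\<in>V. mat_vec V A (\<phi> j) x = lam j * \<phi> j x)" for k
  proof (induction k)
    case 0
    show ?case
      by (rule exI[of _ "\<lambda>_. u"], rule exI[of _ "\<lambda>_. c"]) (simp add: orthonormal_upto_def)
  next
    case (Suc k)
    then obtain \<phi> lam where *: "\<phi> 0 = u" "lam 0 = c" "orthonormal_upto V k \<phi>"
      "\<And>j x. j < k \<Longrightarrow> x \<in> V \<Longrightarrow> mat_vec V A (\<phi> j) x = lam j * \<phi> j x"
      by auto
    show ?case
    \<comment> \<open>The first vector is prescribed; only the later ones come from the Rayleigh
      argument.\<close>
    proof (cases "k = 0")
      case True
      then show ?thesis
        using * u by (intro exI[of _ \<phi>] exI[of _ lam]) (auto simp: orthonormal_upto_def)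
    next
      case False
      have "\<exists>x\<in>V. (\<Sum>j<k. (\<phi> j x)\<^sup>2) \<noteq> 1"
      proof (rule ccontr)
        assume "\<not> ?thesis"
        then have "real (card V) = real k"
          using sum_squares_orthonormal[OF *(3)] by simp
        then show False
          using Suc.prems by simp
      qed
      then obtain x where x: "x \<in> V" "(\<Sum>j<k. (\<phi> j x)\<^sup>2) \<noteq> 1"
        by blast
      have "\<exists>f d. (\<forall>j<k. inner_on V f (\<phi> j) = 0) \<and> inner_on V f f = 1 \<and>
          (\<forall>x\<in>V. mat_vec V A f x = d * f x)"
      proof (rule eigenvector_in_complement[of V A k \<phi> lam "residual k \<phi> x", OF fin sym *(4)])
        show "inner_on V (residual k \<phi> x) (residual k \<phi> x) \<noteq> 0"
          using inner_residual[OF fin x(1) *(3)] x(2) by simp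
      qed (simp_all add: residual_orthogonal[OF fin x(1) *(3)])
      then obtain f d where f: "\<forall>j<k. inner_on V f (\<phi> j) = 0" "inner_on V f f = 1"
          "\<forall>x\<in>V. mat_vec V A f x = d * f x"
        by blast
      have "\<forall>j<k. inner_on V (\<phi> j) f = 0"
        using f(1) by (simp add: inner_on_commute[of V "\<phi> _"])
      then show ?thesis
        using * f False
        by (intro exI[of _ "\<phi>(k := f)"] exI[of _ "lam(k := d)"])
          (auto simp: orthonormal_upto_def less_Suc_eq)
    qed
  qed
  obtain \<phi> lam where *: "\<phi> 0 = u" "lam 0 = c" "orthonormal_upto V (card V) \<phi>"
    "\<And>j x. j < card V \<Longrightarrow> x \<in> V \<Longrightarrow> mat_vec V A (\<phi> j) x = lam j * \<phi> j x"
    using ex[OF order_refl] by auto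
  let ?r = "residual (card V) \<phi>"
  have "(\<Sum>x\<in>V. inner_on V (?r x) (?r x)) = 0"
    using inner_residual[OF fin _ *(3)] sum_squares_orthonormal[OF *(3)]
    by (simp add: sum_subtractf)
  then have "inner_on V (?r x) (?r x) = 0" if "x \<in> V" for x
    using that fin by (subst (asm) sum_nonneg_eq_0_iff) (auto simp: inner_on_self_nonneg)
  then have "?r x y = 0" if "x \<in> V" "y \<in> V" for x y
    using that inner_on_self_eq_0[OF fin] by blast
  then show ?thesis
    using * by (intro that[of \<phi> lam]) (auto simp: residual_def)
qed

section \<open>Intersections of two discrete-time walks\<close>

definition stochastic_on :: "'a set \<Rightarrow> ('a \<Rightarrow> 'a \<Rightarrow> real) \<Rightarrow> bool" where
  "stochastic_on V p \<longleftrightarrow>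
     (\<forall>x\<in>V. \<forall>y\<in>V. 0 \<le> p x y) \<and> (\<forall>x\<in>V. (\<Sum>y\<in>V. p x y) = 1)"

text \<open>The list passed to \<open>f\<close> consists of all \<open>k + 1\<close> states. The
  weights may depend on time because the same sum is later evaluated with the 0/1 matrices of a
  realised path.\<close>

primrec path_sum ::
  "'a set \<Rightarrow> (nat \<Rightarrow> 'a \<Rightarrow> 'a \<Rightarrow> real) \<Rightarrow> nat \<Rightarrow> 'a \<Rightarrow> ('a list \<Rightarrow> real) \<Rightarrow> real" where
  "path_sum V q 0 x f = f [x]"
| "path_sum V q (Suc k) x f =
     (\<Sum>z\<in>V. q 0 x z * path_sum V (\<lambda>i. q (Suc i)) k z (\<lambda>l. f (x # l)))"

abbreviation walk_mean ::
  "'a set \<Rightarrow> ('a \<Rightarrow> 'a \<Rightarrow> real) \<Rightarrow> nat \<Rightarrow> 'a \<Rightarrow> ('a list \<Rightarrow> real) \<Rightarrow> real" where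
  "walk_mean V p \<equiv> path_sum V (\<lambda>_. p)"

lemma path_sum_cong:
  assumes "x \<in> V"
    and "\<And>l. length l = Suc k \<Longrightarrow> set l \<subseteq> V \<Longrightarrow> hd l = x \<Longrightarrow> f l = g l"
  shows "path_sum V q k x f = path_sum V q k x g"
  using assms
proof (induction k arbitrary: q x f g)
  case 0
  then show ?case by simp
next
  case (Suc k)
  have "path_sum V (\<lambda>i. q (Suc i)) k z (\<lambda>l. f (x # l)) =
      path_sum V (\<lambda>i. q (Suc i)) k z (\<lambda>l. g (x # l))" if "z \<in> V" for z
    using Suc.prems that by (intro Suc.IH) auto
  then show ?case by simp
qed

lemma path_sum_add:
  "path_sum V q k x (\<lambda>l. f l + g l) = path_sum V q k x f + path_sum V q k x g"
  by (induction k arbitrary: q x f g) (simp_all add: distrib_left sum.distrib)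

lemma path_sum_cmult: "path_sum V q k x (\<lambda>l. c * f l) = c * path_sum V q k x f"
  by (induction k arbitrary: q x f) (simp_all add: sum_distrib_left mult.left_commute)

lemma path_sum_diff:
  "path_sum V q k x (\<lambda>l. f l - g l) = path_sum V q k x f - path_sum V q k x g"
  using path_sum_add[of V q k x f "\<lambda>l. (-1) * g l"] path_sum_cmult[of V q k x "-1" g] by simp

lemma path_sum_sum:
  "path_sum V q k x (\<lambda>l. \<Sum>i\<in>I. f i l) = (\<Sum>i\<in>I. path_sum V q k x (f i))"
  by (induction k arbitrary: q x f)
    (simp_all add: sum_distrib_left sum.swap[of _ V])

text \<open>Fubini for two independent paths.\<close>

lemma path_sum_swap:
  "path_sum V q k x (\<lambda>l. path_sum V r m y (\<lambda>l'. f l l')) =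
   path_sum V r m y (\<lambda>l'. path_sum V q k x (\<lambda>l. f l l'))"
proof (induction m arbitrary: r y f)
  case 0
  then show ?case by simp
next
  case (Suc m)
  show ?case
    by (simp add: path_sum_sum path_sum_cmult Suc.IH)
qed

lemma path_sum_mono:
  assumes "\<And>i y z. y \<in> V \<Longrightarrow> z \<in> V \<Longrightarrow> 0 \<le> q i y z" "x \<in> V"
    and "\<And>l. length l = Suc k \<Longrightarrow> set l \<subseteq> V \<Longrightarrow> hd l = x \<Longrightarrow> f l \<le> g l"
  shows "path_sum V q k x f \<le> path_sum V q k x g"
  using assms
proof (induction k arbitrary: q x f g)
  case 0
  then show ?case by simp
next
  case (Suc k)
  have "path_sum V (\<lambda>i. q (Suc i)) k z (\<lambda>l. f (x # l)) \<le>
      path_sum V (\<lambda>i. q (Suc i)) k z (\<lambda>l. g (x # l))" if "z \<in> V" for z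
    using Suc.prems that by (intro Suc.IH) auto
  then show ?case
    using Suc.prems by (auto intro!: sum_mono mult_left_mono)
qed

lemma path_sum_nonneg:
  assumes "\<And>i y z. y \<in> V \<Longrightarrow> z \<in> V \<Longrightarrow> 0 \<le> q i y z" "x \<in> V"
    and "\<And>l. length l = Suc k \<Longrightarrow> set l \<subseteq> V \<Longrightarrow> hd l = x \<Longrightarrow> 0 \<le> f l"
  shows "0 \<le> path_sum V q k x f"
  using path_sum_mono[of V q x k "\<lambda>_. 0" f] assms path_sum_cmult[of V q k x 0 "\<lambda>_. 0"] by simp

lemma walk_mean_const:
  assumes "stochastic_on V p" "x \<in> V"
  shows "walk_mean V p k x (\<lambda>_. c) = c"
  using assms(2)
proof (induction k arbitrary: x)
  case (Suc k)
  then show ?case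
    using assms(1) by (simp add: stochastic_on_def sum_distrib_right[symmetric])
qed simp

text \<open>\<open>green V p k x y\<close> is the expected number of visits to \<open>y\<close> up to time \<open>k\<close>, starting from \<open>x\<close>.\<close>

definition green :: "'a set \<Rightarrow> ('a \<Rightarrow> 'a \<Rightarrow> real) \<Rightarrow> nat \<Rightarrow> 'a \<Rightarrow> 'a \<Rightarrow> real" where
  "green V p k x y = (\<Sum>i\<le>k. mat_power V p i x y)"

lemma green_0: "green V p 0 = id_mat"
  by (simp add: green_def fun_eq_iff)

lemma green_Suc: "green V p (Suc k) x y = id_mat x y + (\<Sum>z\<in>V. p x z * green V p k z y)"
  unfolding green_def sum.atMost_Suc_shift
  by (simp add: sum_distrib_left) (rule sum.swap)

lemma green_nonneg:
  assumes "\<And>x y. x \<in> V \<Longrightarrow> y \<in> V \<Longrightarrow> 0 \<le> p x y" "x \<in> V" "y \<in> V"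
  shows "0 \<le> green V p k x y"
  using assms(2)
proof (induction k arbitrary: x)
  case 0
  then show ?case by (simp add: green_0 id_mat_def)
next
  case (Suc k)
  then show ?case
    using assms by (auto simp: green_Suc id_mat_def intro!: add_nonneg_nonneg sum_nonneg)
qed

definition green_op :: "'a set \<Rightarrow> ('a \<Rightarrow> 'a \<Rightarrow> real) \<Rightarrow> nat \<Rightarrow> ('a \<Rightarrow> real) \<Rightarrow> 'a \<Rightarrow> real" where
  "green_op V p k h x = (\<Sum>y\<in>V. green V p k x y * h y)"

lemma sum_id_mat: "finite V \<Longrightarrow> x \<in> V \<Longrightarrow> (\<Sum>y\<in>V. id_mat x y * h y) = h x"
  by (simp add: id_mat_def if_distrib[of "\<lambda>u. u * _"] cong: if_cong)

lemma green_op_0: "finite V \<Longrightarrow> x \<in> V \<Longrightarrow> green_op V p 0 h x = h x"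
  by (simp add: green_op_def green_0 sum_id_mat)

lemma green_op_Suc:
  assumes "finite V" "x \<in> V"
  shows "green_op V p (Suc k) h x = h x + (\<Sum>z\<in>V. p x z * green_op V p k h z)"
proof -
  have "green_op V p (Suc k) h x = h x + (\<Sum>y\<in>V. \<Sum>z\<in>V. p x z * green V p k z y * h y)"
    using assms by (simp add: green_op_def green_Suc distrib_right sum.distrib sum_id_mat sum_distrib_right)
  also have "(\<Sum>y\<in>V. \<Sum>z\<in>V. p x z * green V p k z y * h y) = (\<Sum>z\<in>V. p x z * green_op V p k h z)"
    by (subst sum.swap) (simp add: green_op_def sum_distrib_left mult.assoc)
  finally show ?thesis .
qed

lemma walk_mean_additive:
  assumes "finite V" "stochastic_on V p" "x \<in> V"
  shows "walk_mean V p k x (\<lambda>l. \<Sum>y\<leftarrow>l. h y) = green_op V p k h x"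
  using assms(3)
proof (induction k arbitrary: x)
  case 0
  then show ?case by (simp add: green_op_0 assms)
next
  case (Suc k)
  have "walk_mean V p (Suc k) x (\<lambda>l. \<Sum>y\<leftarrow>l. h y) =
      (\<Sum>z\<in>V. p x z * (h x + walk_mean V p k z (\<lambda>l. \<Sum>y\<leftarrow>l. h y)))"
    by (simp add: path_sum_add walk_mean_const[OF assms(2)])
  also have "\<dots> = h x + (\<Sum>z\<in>V. p x z * green_op V p k h z)"
    using Suc assms(2)
    by (simp add: distrib_left sum.distrib sum_distrib_right[symmetric] stochastic_on_def)
  finally show ?case
    by (simp add: green_op_Suc assms Suc.prems)
qed

lemma green_op_mono:
  assumes "\<And>x y. x \<in> V \<Longrightarrow> y \<in> V \<Longrightarrow> 0 \<le> p x y" "x \<in> V" "\<And>y. y \<in> V \<Longrightarrow> h y \<le> h' y"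
  shows "green_op V p k h x \<le> green_op V p k h' x"
  unfolding green_op_def using assms by (intro sum_mono mult_left_mono green_nonneg) auto

lemma green_op_nonneg:
  assumes "\<And>x y. x \<in> V \<Longrightarrow> y \<in> V \<Longrightarrow> 0 \<le> p x y" "x \<in> V" "\<And>y. y \<in> V \<Longrightarrow> 0 \<le> h y"
  shows "0 \<le> green_op V p k h x"
  unfolding green_op_def using assms by (intro sum_nonneg mult_nonneg_nonneg green_nonneg) auto

lemma green_op_mono_time:
  assumes "stochastic_on V p" "finite V" "x \<in> V" "\<And>y. y \<in> V \<Longrightarrow> 0 \<le> h y" "j \<le> k"
  shows "green_op V p j h x \<le> green_op V p k h x"
proof -
  have *: "mat_power V p i x y \<ge> 0" if "x \<in> V" "y \<in> V" for i x y
    using that(1)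
  proof (induction i arbitrary: x)
    case 0
    then show ?case by (simp add: id_mat_def)
  next
    case (Suc i)
    then show ?case
      using assms(1) by (auto simp: stochastic_on_def intro!: sum_nonneg)
  qed
  show ?thesis
    unfolding green_op_def green_def using assms * by (intro sum_mono mult_right_mono sum_mono2) auto
qed

text \<open>The square is at most twice the sum over pairs of times \<open>i \<le> j\<close>; given
  the state at time \<open>i\<close>, the sum over \<open>j\<close> is bounded by
  \<open>green_op V p m h\<close>. The inner horizon \<open>m\<close> is kept fixed so that it does
  not change while \<open>k\<close> runs through the induction.\<close>

lemma walk_mean_additive_squared:
  assumes "finite V" "stochastic_on V p" "x \<in> V" "\<And>y. y \<in> V \<Longrightarrow> 0 \<le> h y" "k \<le> m"
  shows "walk_mean V p k x (\<lambda>l. (\<Sum>y\<leftarrow>l. h y)\<^sup>2) \<le>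
    2 * green_op V p k (\<lambda>y. h y * green_op V p m h y) x"
  using assms(3,5)
proof (induction k arbitrary: x)
  case 0
  have "h x = green_op V p 0 h x"
    using 0 assms by (simp add: green_op_0)
  also have "\<dots> \<le> green_op V p m h x"
    using 0 assms by (intro green_op_mono_time) auto
  finally have "h x * h x \<le> h x * green_op V p m h x"
    using 0 assms by (intro mult_left_mono) auto
  moreover have "0 \<le> h x * green_op V p m h x"
    using calculation by (rule order_trans[rotated]) simp
  ultimately show ?case
    using 0 assms(1) by (auto simp: green_op_0 power2_eq_square)
next
  case (Suc k)
  let ?H = "\<lambda>y. h y * green_op V p m h y"
  have one: "(\<Sum>z\<in>V. p x z) = 1" and pos: "\<And>z. z \<in> V \<Longrightarrow> 0 \<le> p x z"
    using assms(2) Suc.prems by (auto simp: stochastic_on_def)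
  have "walk_mean V p (Suc k) x (\<lambda>l. (\<Sum>y\<leftarrow>l. h y)\<^sup>2) =
    (\<Sum>z\<in>V. p x z * ((h x)\<^sup>2 + 2 * h x * green_op V p k h z +
      walk_mean V p k z (\<lambda>l. (\<Sum>y\<leftarrow>l. h y)\<^sup>2)))"
  proof -
    have eq: "(h x + u)\<^sup>2 = (h x)\<^sup>2 + (2 * h x) * u + u\<^sup>2" for u
      by (simp add: power2_sum)
    show ?thesis
      by (simp add: eq path_sum_add path_sum_cmult walk_mean_const[OF assms(2)]
          walk_mean_additive[OF assms(1,2)] cong: sum.cong del: power2_sum)
  qed
  also have "\<dots> \<le> (\<Sum>z\<in>V. p x z * ((h x)\<^sup>2 + 2 * h x * green_op V p k h z + 2 * green_op V p k ?H z))"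
    using Suc pos by (intro sum_mono mult_left_mono add_left_mono) auto
  also have "\<dots> = (h x)\<^sup>2 + 2 * h x * (\<Sum>z\<in>V. p x z * green_op V p k h z)
      + 2 * (\<Sum>z\<in>V. p x z * green_op V p k ?H z)"
    using one
    by (simp add: distrib_left sum.distrib sum_distrib_right[symmetric] sum_distrib_left mult.left_commute)
  \<comment> \<open>The diagonal term \<open>(h x)^2\<close> is counted twice, so that the bracket
    becomes the Green operator for \<open>Suc k\<close> steps.\<close>
  also have "\<dots> \<le> 2 * h x * (h x + (\<Sum>z\<in>V. p x z * green_op V p k h z))
      + 2 * (\<Sum>z\<in>V. p x z * green_op V p k ?H z)"
    by (simp add: algebra_simps power2_eq_square)
  also have "\<dots> = 2 * h x * green_op V p (Suc k) h x + 2 * (\<Sum>z\<in>V. p x z * green_op V p k ?H z)"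
    using Suc.prems assms(1) by (simp add: green_op_Suc)
  also have "\<dots> \<le> 2 * h x * green_op V p m h x + 2 * (\<Sum>z\<in>V. p x z * green_op V p k ?H z)"
    using Suc.prems assms green_op_mono_time[OF assms(2,1) Suc.prems(1) assms(4) Suc.prems(2)]
    by (intro add_right_mono mult_left_mono) auto
  also have "\<dots> = 2 * green_op V p (Suc k) ?H x"
    using Suc.prems assms(1) by (simp add: green_op_Suc)
  finally show ?case .
qed

section \<open>Good paths by the second-moment method\<close>

definition green_sq :: "'a set \<Rightarrow> ('a \<Rightarrow> 'a \<Rightarrow> real) \<Rightarrow> nat \<Rightarrow> 'a \<Rightarrow> real" where
  "green_sq V p m x = (\<Sum>y\<in>V. (green V p m x y)\<^sup>2)"

text \<open>The sum is the expected number of visits, with multiplicity, that an independent walk of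
  \<open>m\<close> steps from the same starting point pays to the first \<open>m + 1\<close> states
  of \<open>l\<close>. Its mean over \<open>l\<close> is \<open>green_sq\<close>, the expected
  number of pairs of times at which two independent walks agree; \<open>s\<close> will be that
  mean.\<close>

definition good_path :: "'a set \<Rightarrow> ('a \<Rightarrow> 'a \<Rightarrow> real) \<Rightarrow> nat \<Rightarrow> real \<Rightarrow> 'a list \<Rightarrow> bool" where
  "good_path V p m s l \<longleftrightarrow> s / 2 \<le> (\<Sum>y\<leftarrow>take (Suc m) l. green V p m (hd l) y)"

lemma walk_mean_take:
  assumes "stochastic_on V p" "x \<in> V"
  shows "walk_mean V p (m + r) x (\<lambda>l. f (take (Suc m) l)) = walk_mean V p m x f"
  using assms(2)
proof (induction m arbitrary: x f)
  case 0
  have "walk_mean V p r x (\<lambda>l. f (take (Suc 0) l)) = walk_mean V p r x (\<lambda>_. f [x])"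
    using 0 by (intro path_sum_cong) (auto simp: length_Suc_conv)
  then show ?case
    using walk_mean_const[OF assms(1) 0] by simp
next
  case (Suc m)
  then show ?case
    using Suc.IH[of _ "\<lambda>l. f (x # l)"] by simp
qed

text \<open>Let \<open>D\<close> be the total of \<open>green V p m x\<close> along the path. Its
  mean is \<open>S\<close>, and its second moment is at most \<open>2 S^2\<close>: a mixed sum
  \<open>\<Sum> g(y,z) g(x,z)\<close> is at most \<open>S\<close>, because \<open>green_sq\<close>
  takes the same value at \<open>x\<close> and \<open>y\<close>. Paley-Zygmund at half the mean
  gives \<open>(1/2)^2 * S^2 / (2 S^2) = 1/8\<close>. Goodness looks only at the first
  \<open>m + 1\<close> states, so \<open>r\<close> further steps change nothing.\<close>

lemma good_path_probability:
  assumes fin: "finite V" and p: "stochastic_on V p" and x: "x \<in> V"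
    and S: "\<And>y. y \<in> V \<Longrightarrow> green_sq V p m y = S" and pos: "S > 0"
    and sym: "\<And>y z. y \<in> V \<Longrightarrow> z \<in> V \<Longrightarrow> green V p m y z = green V p m z y"
  shows "1 / 8 \<le> walk_mean V p (m + r) x (\<lambda>l. of_bool (good_path V p m S l))"
proof -
  define h where "h = green V p m x"
  define D where "D l = (\<Sum>y\<leftarrow>l. h y)" for l
  have pnn: "\<And>y z. y \<in> V \<Longrightarrow> z \<in> V \<Longrightarrow> 0 \<le> p y z"
    using p by (auto simp: stochastic_on_def)
  have hnn: "0 \<le> h y" if "y \<in> V" for y
    unfolding h_def using pnn x that by (rule green_nonneg)
  have ED: "walk_mean V p m x D = S"
    using S[OF x] walk_mean_additive[OF fin p x, of m h]
    by (simp add: D_def[abs_def] green_op_def green_sq_def power2_eq_square h_def)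
  have CS: "green_op V p m h y \<le> S" if "y \<in> V" for y
  proof -
    have "green_op V p m h y \<le> (\<Sum>z\<in>V. ((green V p m y z)\<^sup>2 + (h z)\<^sup>2) / 2)"
      unfolding green_op_def
    proof (rule sum_mono)
      show "green V p m y z * h z \<le> ((green V p m y z)\<^sup>2 + (h z)\<^sup>2) / 2" for z
        using sum_squares_bound[of "green V p m y z" "h z"] by simp
    qed
    also have "\<dots> = (green_sq V p m y + green_sq V p m x) / 2"
      by (simp add: green_sq_def h_def sum.distrib sum_divide_distrib[symmetric])
    finally show ?thesis
      using S that x by simp
  qed
  have "walk_mean V p m x (\<lambda>l. (D l)\<^sup>2) \<le> 2 * green_op V p m (\<lambda>y. h y * green_op V p m h y) x"
    unfolding D_def using hnn by (intro walk_mean_additive_squared fin p x) auto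
  also have "\<dots> \<le> 2 * green_op V p m (\<lambda>y. S * h y) x"
    using CS hnn pos by (intro mult_left_mono green_op_mono pnn x) (auto simp: mult.commute[of S] intro!: mult_left_mono)
  also have "\<dots> = 2 * S * green_op V p m h x"
    by (simp add: green_op_def sum_distrib_left mult_ac)
  also have "\<dots> \<le> 2 * S * S"
    using CS[OF x] pos by (intro mult_left_mono) auto
  finally have ED2: "walk_mean V p m x (\<lambda>l. (D l)\<^sup>2) \<le> 2 * S * S" .
  \<comment> \<open>Paley--Zygmund, from \<open>D \<le> D\<^sup>2 / (8 S) + 2 S\<close> on the event \<open>D \<ge> S / 2\<close>\<close>
  have "S = walk_mean V p m x D"
    by (simp add: ED)
  also have "\<dots> \<le> walk_mean V p m x (\<lambda>l. S / 2 + (1 / (8 * S) * (D l)\<^sup>2 + 2 * S * of_bool (S / 2 \<le> D l)))"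
  proof (rule path_sum_mono[OF pnn x])
    fix l :: "'a list"
    show "D l \<le> S / 2 + (1 / (8 * S) * (D l)\<^sup>2 + 2 * S * of_bool (S / 2 \<le> D l))"
    proof (cases "S / 2 \<le> D l")
      case True
      have "0 \<le> (D l - 4 * S)\<^sup>2"
        by simp
      then have "8 * S * D l \<le> (D l)\<^sup>2 + 16 * S * S"
        by (simp add: power2_eq_square algebra_simps)
      then have "D l \<le> ((D l)\<^sup>2 + 16 * S * S) / (8 * S)"
        using pos by (simp add: le_divide_eq mult.commute mult.left_commute)
      also have "\<dots> = 1 / (8 * S) * (D l)\<^sup>2 + 2 * S"
        using pos by (simp add: field_simps)
      finally show ?thesis
        using True pos by simp
    next
      case False
      moreover have "0 \<le> 1 / (8 * S) * (D l)\<^sup>2"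
        using pos by simp
      ultimately show ?thesis
        by simp
    qed
  qed
  also have "\<dots> = S / 2 + (1 / (8 * S) * walk_mean V p m x (\<lambda>l. (D l)\<^sup>2)
      + 2 * S * walk_mean V p m x (\<lambda>l. of_bool (S / 2 \<le> D l)))"
    by (simp only: path_sum_add path_sum_cmult walk_mean_const[OF p x])
  also have "1 / (8 * S) * walk_mean V p m x (\<lambda>l. (D l)\<^sup>2) \<le> 1 / (8 * S) * (2 * S * S)"
    using ED2 pos by (intro mult_left_mono) auto
  also have "\<dots> = S / 4"
    using pos by (simp add: field_simps)
  finally have "1 / 8 \<le> walk_mean V p m x (\<lambda>l. of_bool (S / 2 \<le> D l))"
    using pos by (simp add: field_simps)
  also have "\<dots> = walk_mean V p (m + r) x (\<lambda>l. of_bool (S / 2 \<le> D (take (Suc m) l)))"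
    by (rule walk_mean_take[OF p x, symmetric])
  also have "\<dots> = walk_mean V p (m + r) x (\<lambda>l. of_bool (good_path V p m S l))"
    by (rule path_sum_cong[OF x]) (simp add: good_path_def D_def h_def)
  finally show ?thesis .
qed

section \<open>Decomposition at the first hit\<close>

lemma ex_le_Suc_iff: "(\<exists>i\<le>Suc k. R i) \<longleftrightarrow> R 0 \<or> (\<exists>i\<le>k. R (Suc i))"
  by (metis Suc_le_mono le0 not0_implies_Suc)

text \<open>The Markov property at the first hit of \<open>B\<close>, obtained by peeling off one
  step at a time as long as the walk is outside \<open>B\<close>. A path of \<open>m + k\<close>
  steps that hits by time \<open>k\<close> has at least \<open>m\<close> steps left;
  \<open>r\<close> in the hypothesis absorbs the surplus.\<close>

lemma first_hit_is_good:
  assumes p: "stochastic_on V p" and x: "x \<in> V"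
    and c: "\<And>x r. x \<in> V \<Longrightarrow> c \<le> walk_mean V p (m + r) x (\<lambda>l. of_bool (G l))" "0 \<le> c"
  shows "c * walk_mean V p (m + k) x (\<lambda>l. of_bool (\<exists>i\<le>k. l ! i \<in> B)) \<le>
    walk_mean V p (m + k) x (\<lambda>l. of_bool (\<exists>i\<le>k. l ! i \<in> B \<and> G (drop i l)))"
proof -
  have pnn: "\<And>y z. y \<in> V \<Longrightarrow> z \<in> V \<Longrightarrow> 0 \<le> p y z"
    using p by (auto simp: stochastic_on_def)
  have start: "c * walk_mean V p (m + k) x (\<lambda>l. of_bool (\<exists>i\<le>k. l ! i \<in> B)) \<le>
    walk_mean V p (m + k) x (\<lambda>l. of_bool (\<exists>i\<le>k. l ! i \<in> B \<and> G (drop i l)))"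
    if "x \<in> V" "x \<in> B" for x k
  proof -
    have "walk_mean V p (m + k) x (\<lambda>l. of_bool (\<exists>i\<le>k. l ! i \<in> B)) \<le> walk_mean V p (m + k) x (\<lambda>_. 1)"
      by (rule path_sum_mono[OF pnn that(1)]) auto
    then have "c * walk_mean V p (m + k) x (\<lambda>l. of_bool (\<exists>i\<le>k. l ! i \<in> B)) \<le> c * 1"
      using walk_mean_const[OF p that(1)] c(2) by (intro mult_left_mono) auto
    also have "\<dots> \<le> walk_mean V p (m + k) x (\<lambda>l. of_bool (G l))"
      using c(1)[OF that(1)] by simp
    also have "\<dots> \<le> walk_mean V p (m + k) x (\<lambda>l. of_bool (\<exists>i\<le>k. l ! i \<in> B \<and> G (drop i l)))"
    proof (rule path_sum_mono[OF pnn that(1)])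
      fix l :: "'a list"
      assume "length l = Suc (m + k)" "hd l = x"
      then have "l ! 0 = x"
        by (cases l) auto
      then show "(of_bool (G l) :: real) \<le> of_bool (\<exists>i\<le>k. l ! i \<in> B \<and> G (drop i l))"
        using that(2) by (auto intro!: exI[of _ 0])
    qed auto
    finally show ?thesis .
  qed
  show ?thesis
    using x
  proof (induction k arbitrary: x)
    case 0
    show ?case
    proof (cases "x \<in> B")
      case True
      then show ?thesis
        using start 0 by blast
    next
      case False
      have "walk_mean V p m x (\<lambda>l. of_bool (l ! 0 \<in> B)) = walk_mean V p m x (\<lambda>_. 0)"
        using 0 False by (intro path_sum_cong) (auto simp: hd_conv_nth[symmetric] length_Suc_conv)
      moreover have "0 \<le> walk_mean V p m x (\<lambda>l. of_bool (l ! 0 \<in> B \<and> G l))"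
        using 0 by (intro path_sum_nonneg pnn) auto
      ultimately show ?thesis
        using walk_mean_const[OF p 0, of m 0] by simp
    qed
  next
    case (Suc k)
    show ?case
    proof (cases "x \<in> B")
      case True
      then show ?thesis
        using start Suc.prems by blast
    next
      case False
      then show ?thesis
        using Suc pnn
        by (simp add: ex_le_Suc_iff sum_distrib_left mult.left_commute[of c])
          (intro sum_mono mult_left_mono, auto)
    qed
  qed
qed

text \<open>The same peeling: from the first hit, at a time up to \<open>k\<close>, the next
  \<open>m\<close> steps collect at least \<open>s\<close> on average, and all of this happens
  within \<open>m + k\<close> steps.\<close>

lemma hit_times_visits_le:
  assumes fin: "finite V" and p: "stochastic_on V p" and x: "x \<in> V"
    and h: "\<And>y. y \<in> V \<Longrightarrow> 0 \<le> h y"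
    and s: "\<And>y. y \<in> V \<Longrightarrow> y \<in> B \<Longrightarrow> s \<le> green_op V p m h y" "0 \<le> s"
  shows "s * walk_mean V p k x (\<lambda>l. of_bool (\<exists>i\<le>k. l ! i \<in> B)) \<le> green_op V p (m + k) h x"
proof -
  have pnn: "\<And>y z. y \<in> V \<Longrightarrow> z \<in> V \<Longrightarrow> 0 \<le> p y z"
    using p by (auto simp: stochastic_on_def)
  have start: "s * walk_mean V p k x (\<lambda>l. of_bool (\<exists>i\<le>k. l ! i \<in> B)) \<le> green_op V p (m + k) h x"
    if "x \<in> V" "x \<in> B" for x k
  proof -
    have "walk_mean V p k x (\<lambda>l. of_bool (\<exists>i\<le>k. l ! i \<in> B)) \<le> walk_mean V p k x (\<lambda>_. 1)"
      by (rule path_sum_mono[OF pnn that(1)]) auto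
    then have "s * walk_mean V p k x (\<lambda>l. of_bool (\<exists>i\<le>k. l ! i \<in> B)) \<le> s * 1"
      using walk_mean_const[OF p that(1)] s(2) by (intro mult_left_mono) auto
    also have "\<dots> \<le> green_op V p m h x"
      using s(1) that by simp
    also have "\<dots> \<le> green_op V p (m + k) h x"
      using that fin p h by (intro green_op_mono_time) auto
    finally show ?thesis .
  qed
  show ?thesis
    using x
  proof (induction k arbitrary: x)
    case 0
    then show ?case
      using start[OF 0, of 0] green_op_nonneg[of V p x h m, OF pnn 0 h] by (cases "x \<in> B") auto
  next
    case (Suc k)
    show ?case
    proof (cases "x \<in> B")
      case True
      then show ?thesis
        using start Suc.prems by blast
    next
      case False
      have "s * walk_mean V p (Suc k) x (\<lambda>l. of_bool (\<exists>i\<le>Suc k. l ! i \<in> B)) =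
          (\<Sum>z\<in>V. p x z * (s * walk_mean V p k z (\<lambda>l. of_bool (\<exists>i\<le>k. l ! i \<in> B))))"
        using False by (simp add: ex_le_Suc_iff sum_distrib_left mult.left_commute[of s])
      also have "\<dots> \<le> (\<Sum>z\<in>V. p x z * green_op V p (m + k) h z)"
        using Suc pnn by (intro sum_mono mult_left_mono) auto
      also have "\<dots> \<le> green_op V p (m + Suc k) h x"
        using Suc.prems h fin by (simp add: green_op_Suc)
      finally show ?thesis .
    qed
  qed
qed

lemma sum_mult_count_list:
  assumes "finite V" "set l \<subseteq> V"
  shows "(\<Sum>z\<in>V. h z * real (count_list l z)) = (\<Sum>z\<leftarrow>l. h z)"
  using assms(2)
proof (induction l)
  case (Cons a l)
  have "(\<Sum>z\<in>V. h z * real (count_list (a # l) z)) =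
      (\<Sum>z\<in>V. h z * real (count_list l z) + (if z = a then h a else 0))"
    by (intro sum.cong) (auto simp: algebra_simps)
  then show ?case
    using Cons assms(1) by (simp add: sum.distrib)
qed simp

lemma sum_list_sublist_le:
  assumes "\<And>y. y \<in> set l \<Longrightarrow> 0 \<le> h y"
  shows "(\<Sum>y\<leftarrow>take j (drop i l). h y) \<le> (\<Sum>y\<leftarrow>l. h y :: real)"
proof -
  have split: "l = take i l @ take j (drop i l) @ drop j (drop i l)"
    by (metis append_take_drop_id)
  have "0 \<le> (\<Sum>y\<leftarrow>take i l. h y)" "0 \<le> (\<Sum>y\<leftarrow>drop j (drop i l). h y)"
    using in_set_takeD[of _ i l] in_set_dropD[of _ "j + i" l] assms by (auto intro!: sum_list_nonneg)
  moreover have "(\<Sum>y\<leftarrow>l. h y) = (\<Sum>y\<leftarrow>take i l. h y) + (\<Sum>y\<leftarrow>take j (drop i l). h y)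
      + (\<Sum>y\<leftarrow>drop j (drop i l). h y)"
    by (subst split) (simp only: map_append sum_list_append add.assoc)
  ultimately show ?thesis
    by simp
qed

lemma green_op_one:
  assumes "finite V" "stochastic_on V p" "x \<in> V"
  shows "green_op V p k (\<lambda>_. 1) x = real (Suc k)"
  using assms(3)
proof (induction k arbitrary: x)
  case 0
  then show ?case by (simp add: green_op_0 assms)
next
  case (Suc k)
  then show ?case
    using assms by (simp add: green_op_Suc sum_distrib_right[symmetric] stochastic_on_def)
qed

text \<open>
  The paths \<open>X\<close> (followed for \<open>2m\<close> steps) and \<open>Y\<close> meet within \<open>m\<close> steps. When \<open>X\<close> first hits the
  range of \<open>Y\<close>, its future path is good with probability at least \<open>1/8\<close>, independently of \<open>Y\<close>; and
  when \<open>Y\<close> first hits a good point of \<open>X\<close>, it has at least \<open>S/2\<close> expected visits to the range of \<open>X\<close>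
  ahead. On average over the starting point of \<open>Y\<close> the total number of visits is \<open>(2m + 1)\<^sup>2 / |V|\<close>.
\<close>

lemma intersection_probability_le:
  assumes fin: "finite V" and p: "stochastic_on V p" and x: "x \<in> V"
    and S: "\<And>y. y \<in> V \<Longrightarrow> green_sq V p m y = S" and pos: "S > 0"
    and sym: "\<And>k y z. y \<in> V \<Longrightarrow> z \<in> V \<Longrightarrow> green V p k y z = green V p k z y"
  shows "(\<Sum>y\<in>V. walk_mean V p (m + m) x (\<lambda>l. walk_mean V p m y (\<lambda>l'. of_bool (\<exists>i\<le>m. l ! i \<in> set l'))))
    \<le> 16 * (2 * real m + 1)\<^sup>2 / S"
proof -
  let ?X = "walk_mean V p (m + m) x"
  let ?Y = "walk_mean V p m"
  let ?G = "good_path V p m S"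
  define h where "h l z = real (count_list l z)" for l and z :: 'a
  have pnn: "\<And>y z. y \<in> V \<Longrightarrow> z \<in> V \<Longrightarrow> 0 \<le> p y z"
    using p by (auto simp: stochastic_on_def)
  have good: "1 / 8 \<le> walk_mean V p (m + r) y (\<lambda>l. of_bool (?G l))" if "y \<in> V" for y r
    by (rule good_path_probability[OF fin p that S pos sym])
  have green_op_h: "green_op V p k (h l) y = (\<Sum>z\<leftarrow>l. green V p k y z)" if "set l \<subseteq> V" for k l y
    using sum_mult_count_list[OF fin that] by (simp add: green_op_def h_def)
  have visits: "S / 2 * ?Y y (\<lambda>l'. of_bool (\<exists>i\<le>m. l ! i \<in> set l' \<and> ?G (drop i l))) \<le> green_op V p (m + m) (h l) y"
    if y: "y \<in> V" and l: "length l = Suc (m + m)" "set l \<subseteq> V" for y l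
  proof -
    \<comment> \<open>With \<open>l\<close> frozen, meeting at a good point of \<open>l\<close>
      becomes the hitting of a fixed set.\<close>
    define B where "B = {l ! i |i. i \<le> m \<and> ?G (drop i l)}"
    have "?Y y (\<lambda>l'. of_bool (\<exists>i\<le>m. l ! i \<in> set l' \<and> ?G (drop i l))) =
        ?Y y (\<lambda>l'. of_bool (\<exists>i\<le>m. l' ! i \<in> B))"
    proof (rule path_sum_cong[OF y])
      fix l' :: "'a list"
      assume "length l' = Suc m"
      then have "set l' = {l' ! j |j. j \<le> m}"
        by (auto simp: set_conv_nth less_Suc_eq_le)
      then show "of_bool (\<exists>i\<le>m. l ! i \<in> set l' \<and> ?G (drop i l)) = (of_bool (\<exists>i\<le>m. l' ! i \<in> B) :: real)"
        by (intro arg_cong[where f = of_bool]) (auto simp: B_def, metis+)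
    qed
    moreover have "S / 2 \<le> green_op V p m (h l) y" if "y \<in> V" "y \<in> B" for y
    proof -
      obtain i where i: "y = l ! i" "i \<le> m" "?G (drop i l)"
        using \<open>y \<in> B\<close> by (auto simp: B_def)
      then have "S / 2 \<le> (\<Sum>z\<leftarrow>take (Suc m) (drop i l). green V p m y z)"
        using l(1) by (simp add: good_path_def hd_drop_conv_nth)
      also have "\<dots> \<le> (\<Sum>z\<leftarrow>l. green V p m y z)"
        using l(2) \<open>y \<in> V\<close> pnn by (intro sum_list_sublist_le green_nonneg) auto
      finally show ?thesis
        using green_op_h[OF l(2)] by simp
    qed
    ultimately show ?thesis
      using hit_times_visits_le[OF fin p y, where h = "h l" and B = B and s = "S / 2" and m = m and k = m] pos
      by (simp add: h_def)
  qed
  \<comment> \<open>The factor is \<open>S/2\<close> times \<open>1/8\<close>. Each walk is handled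
    with the other one frozen, and swapping the path sums passes between the two views:
    \<open>1/8\<close> goes to \<open>X\<close> for fixed \<open>Y\<close>, then \<open>S/2\<close>
    to \<open>Y\<close> for fixed \<open>X\<close>.\<close>
  have "S / 16 * (\<Sum>y\<in>V. ?X (\<lambda>l. ?Y y (\<lambda>l'. of_bool (\<exists>i\<le>m. l ! i \<in> set l')))) =
      (\<Sum>y\<in>V. S / 2 * ?Y y (\<lambda>l'. 1 / 8 * ?X (\<lambda>l. of_bool (\<exists>i\<le>m. l ! i \<in> set l'))))"
    unfolding path_sum_cmult by (subst path_sum_swap) (simp add: sum_distrib_left)
  also have "\<dots> \<le> (\<Sum>y\<in>V. S / 2 * ?Y y (\<lambda>l'. ?X (\<lambda>l. of_bool (\<exists>i\<le>m. l ! i \<in> set l' \<and> ?G (drop i l)))))"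
    using pos good
    by (intro sum_mono mult_left_mono path_sum_mono pnn first_hit_is_good[OF p x]) auto
  also have "\<dots> = (\<Sum>y\<in>V. ?X (\<lambda>l. S / 2 * ?Y y (\<lambda>l'. of_bool (\<exists>i\<le>m. l ! i \<in> set l' \<and> ?G (drop i l)))))"
    unfolding path_sum_cmult by (subst path_sum_swap) (rule refl)
  also have "\<dots> \<le> (\<Sum>y\<in>V. ?X (\<lambda>l. green_op V p (m + m) (h l) y))"
    using visits by (intro sum_mono path_sum_mono pnn x)
  also have "\<dots> = ?X (\<lambda>l. \<Sum>y\<in>V. green_op V p (m + m) (h l) y)"
    by (rule path_sum_sum[symmetric])
  also have "\<dots> = ?X (\<lambda>_. (2 * real m + 1)\<^sup>2)"
  proof (rule path_sum_cong[OF x])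
    fix l :: "'a list"
    assume l: "length l = Suc (m + m)" "set l \<subseteq> V"
    have "(\<Sum>y\<in>V. green_op V p (m + m) (h l) y) = (\<Sum>z\<in>V. (\<Sum>y\<in>V. green V p (m + m) y z) * h l z)"
      unfolding green_op_def by (subst sum.swap) (simp add: sum_distrib_right)
    \<comment> \<open>Summing over the start of \<open>Y\<close> gives a column sum of the Green
      function, which symmetry turns into a row sum.\<close>
    also have "\<dots> = (\<Sum>z\<in>V. real (Suc (m + m)) * h l z)"
    proof (intro sum.cong refl arg_cong2[where f = "(*)"])
      fix z assume "z \<in> V"
      then show "(\<Sum>y\<in>V. green V p (m + m) y z) = real (Suc (m + m))"
        using green_op_one[OF fin p, of z "m + m"] sym by (simp add: green_op_def cong: sum.cong)
    qed
    also have "\<dots> = real (Suc (m + m)) * real (Suc (m + m))"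
      unfolding h_def using sum_mult_count_list[OF fin l(2), of "\<lambda>_. real (Suc (m + m))"] l(1)
      by (simp add: sum_list_triv)
    finally show "(\<Sum>y\<in>V. green_op V p (m + m) (h l) y) = (2 * real m + 1)\<^sup>2"
      by (simp add: power2_eq_square algebra_simps)
  qed
  also have "\<dots> = (2 * real m + 1)\<^sup>2"
    by (rule walk_mean_const[OF p x])
  finally show ?thesis
    using pos by (simp add: field_simps)
qed

section \<open>From the continuous-time chain to its jump chain\<close>

text \<open>
  \<open>path_sum V (step_mat \<omega>) k x f\<close> is \<open>f\<close> of the first \<open>k + 1\<close> states of the jump chain if these lie
  in \<open>V\<close>, and 0 otherwise. Unlike the jump chain itself, this finite sum is measurable in \<open>\<omega>\<close> even
  when \<open>'a\<close> is uncountable.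
\<close>

definition step_mat :: "(('a \<Rightarrow> 'a) \<times> real) stream \<Rightarrow> nat \<Rightarrow> 'a \<Rightarrow> 'a \<Rightarrow> real" where
  "step_mat \<omega> i x z = of_bool (fst (\<omega> !! i) x = z)"

section \<open>The driving randomness and its product structure\<close>

definition hold_measure :: "real measure" where
  "hold_measure = density lborel (\<lambda>s. ennreal (exponential_density 1 s))"

definition step_measure :: "'a set \<Rightarrow> ('a \<Rightarrow> 'a pmf) \<Rightarrow> (('a \<Rightarrow> 'a) \<times> real) measure" where
  "step_measure V P = measure_pmf (Pi_pmf V undefined P) \<Otimes>\<^sub>M hold_measure"

lemma driving_measure_eq: "driving_measure V P = stream_space (step_measure V P)"
  by (simp add: driving_measure_def step_measure_def hold_measure_def)

lemma prob_space_hold_measure: "prob_space hold_measure"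
  unfolding hold_measure_def by (rule prob_space_exponential_density) simp

lemma sets_hold_measure [measurable_cong]: "sets hold_measure = sets borel"
  by (simp add: hold_measure_def)

lemma prob_space_step_measure: "prob_space (step_measure V P)"
proof -
  interpret H: prob_space hold_measure
    by (rule prob_space_hold_measure)
  interpret pair_prob_space "measure_pmf (Pi_pmf V undefined P)" hold_measure ..
  show ?thesis
    unfolding step_measure_def by unfold_locales
qed

lemma prob_space_driving_measure: "prob_space (driving_measure V P)"
  unfolding driving_measure_eq by (rule prob_space.prob_space_stream_space[OF prob_space_step_measure])

lemma emeasure_hold_measure_gt_1: "emeasure hold_measure {1<..} = ennreal (exp (- 1))"
proof -
  interpret prob_space hold_measure
    by (rule prob_space_hold_measure)
  have "distributed hold_measure lborel (\<lambda>x. x) (exponential_density 1)"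
    by (auto simp: distributed_def hold_measure_def distr_id2)
  from exponential_distributedD_gt[OF this, of 1]
  have "prob {s \<in> space hold_measure. 1 < s} = exp (- 1)"
    by simp
  moreover have "{s \<in> space hold_measure. 1 < s} = {1<..}"
    by (auto simp: hold_measure_def)
  ultimately show ?thesis
    by (simp add: emeasure_eq_measure)
qed

lemma AE_hold_measure: "AE s in hold_measure. 0 \<le> s"
  unfolding hold_measure_def by (subst AE_density) (auto simp: exponential_density_def)

lemma measurable_fst_step [measurable]:
  "(\<lambda>a. fst a x) \<in> measurable (step_measure V P) (count_space UNIV)"
  unfolding step_measure_def by (rule measurable_compose[OF measurable_fst]) simp

lemma measurable_snd_step [measurable]: "snd \<in> borel_measurable (step_measure V P)"
  unfolding step_measure_def by measurable

lemma measurable_snd_driving [measurable]: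
  "(\<lambda>\<omega>. snd (\<omega> !! i)) \<in> borel_measurable (driving_measure V P)"
  unfolding driving_measure_eq by measurable

lemma measurable_step_mat [measurable]:
  "(\<lambda>\<omega>. step_mat \<omega> i x z) \<in> borel_measurable (driving_measure V P)"
proof -
  have [measurable]: "(\<lambda>\<omega>. fst (\<omega> !! i) x) \<in> measurable (driving_measure V P) (count_space UNIV)"
    unfolding driving_measure_eq by measurable
  show ?thesis
    unfolding step_mat_def by measurable
qed

lemma measurable_path_sum:
  assumes "\<And>i x z. (\<lambda>\<omega>. q \<omega> i x z) \<in> borel_measurable N"
    and "\<And>l. (\<lambda>\<omega>. f \<omega> l) \<in> borel_measurable N"
  shows "(\<lambda>\<omega>. path_sum V (q \<omega>) k x (f \<omega>)) \<in> borel_measurable N"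
  using assms
proof (induction k arbitrary: q x f)
  case (Suc k)
  have "(\<lambda>\<omega>. path_sum V (\<lambda>i. q \<omega> (Suc i)) k z (\<lambda>l. f \<omega> (x # l))) \<in> borel_measurable N" for z
    by (rule Suc.IH) (rule Suc.prems)+
  then show ?case
    using Suc.prems(1) by simp
qed simp

lemma emeasure_step_measure:
  assumes "finite V" "x \<in> V" "T \<in> sets borel"
  shows "emeasure (step_measure V P) ({F. F x = z} \<times> T) =
    ennreal (pmf (P x) z) * emeasure hold_measure T"
proof -
  interpret H: prob_space hold_measure
    by (rule prob_space_hold_measure)
  have "emeasure (measure_pmf (Pi_pmf V undefined P)) {F. F x = z} =
      emeasure (map_pmf (\<lambda>F. F x) (Pi_pmf V undefined P)) {z}"
    by (simp add: vimage_def)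
  also have "\<dots> = ennreal (pmf (P x) z)"
    using assms by (simp add: Pi_pmf_component emeasure_pmf_single)
  finally show ?thesis
    using assms(3) by (simp add: step_measure_def H.emeasure_pair_measure_Times sets_hold_measure)
qed

lemma path_sum_step_mat_Suc:
  "path_sum V (step_mat (a ## \<omega>)) (Suc k) x f =
    (\<Sum>z\<in>V. of_bool (fst a x = z) * path_sum V (step_mat \<omega>) k z (\<lambda>l. f (x # l)))"
  by (simp add: step_mat_def[abs_def])

lemma nn_integral_hold:
  assumes [measurable]: "T \<in> sets borel"
  shows "(\<integral>\<^sup>+\<omega>. indicator T (snd (\<omega> !! i)) \<partial>driving_measure V P) = emeasure hold_measure T"
proof -
  interpret S: prob_space "step_measure V P"
    by (rule prob_space_step_measure)
  interpret D: prob_space "driving_measure V P"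
    by (rule prob_space_driving_measure)
  show ?thesis
  proof (induction i)
    case 0
    interpret H: prob_space hold_measure
      by (rule prob_space_hold_measure)
    have "(\<integral>\<^sup>+\<omega>. indicator T (snd (\<omega> !! 0)) \<partial>driving_measure V P) =
        (\<integral>\<^sup>+a. indicator T (snd a) \<partial>step_measure V P)"
      unfolding driving_measure_eq
      by (subst S.nn_integral_stream_space)
        (simp_all add: D.emeasure_space_1[unfolded driving_measure_eq])
    also have "\<dots> = (\<integral>\<^sup>+a. indicator (UNIV \<times> T) a \<partial>step_measure V P)"
      by (intro nn_integral_cong) (auto simp: indicator_def)
    also have "\<dots> = emeasure (step_measure V P) (UNIV \<times> T)"
      by (rule nn_integral_indicator) (simp add: step_measure_def)
    also have "\<dots> = emeasure hold_measure T"
      using assms by (simp add: step_measure_def H.emeasure_pair_measure_Times sets_hold_measure)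
    finally show ?case .
  next
    case (Suc i)
    show ?case
      using Suc unfolding driving_measure_eq
      by (subst S.nn_integral_stream_space) (simp_all add: S.emeasure_space_1)
  qed
qed

text \<open>Jumps and holding times are independent, so the path functional and the event on one
  holding time separate. The induction conditions on the first step and carries the indicator along,
  which is why \<open>i\<close> and \<open>T\<close> vary.\<close>

lemma nn_integral_path_sum:
  assumes fin: "finite V" and x: "x \<in> V" and f: "\<And>l. 0 \<le> f l" and T: "T \<in> sets borel"
  shows "(\<integral>\<^sup>+\<omega>. ennreal (path_sum V (step_mat \<omega>) k x f) * indicator T (snd (\<omega> !! i)) \<partial>driving_measure V P) =
    ennreal (walk_mean V (trans_mat P) k x f) * emeasure hold_measure T"
  using x f T
proof (induction k arbitrary: i x f T)
  case 0
  then have [measurable]: "T \<in> sets borel"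
    by simp
  show ?case
    by (simp add: nn_integral_cmult nn_integral_hold)
next
  case (Suc k)
  note [measurable] = Suc.prems(3)
  interpret S: prob_space "step_measure V P"
    by (rule prob_space_step_measure)
  have meas [measurable]: "(\<lambda>\<omega>. path_sum V (step_mat \<omega>) k x f) \<in> borel_measurable (driving_measure V P)" for k x f
    by (rule measurable_path_sum) measurable
  \<comment> \<open>Exactly one of \<open>T0\<close> and \<open>T1\<close> is \<open>T\<close>; the
    other is everything and has mass 1. For \<open>i = 0\<close> the index \<open>i - 1\<close> is
    again 0, which is harmless since \<open>T1\<close> is then \<open>UNIV\<close>.\<close>
  define T0 where "T0 = (if i = 0 then T else UNIV)"
  define T1 where "T1 = (if i = 0 then UNIV else T)"
  have [measurable]: "T0 \<in> sets borel" "T1 \<in> sets borel"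
    using Suc.prems by (auto simp: T0_def T1_def)
  have ind: "indicator T (snd ((a ## \<omega>) !! i)) =
      (indicator T0 (snd a) * indicator T1 (snd (\<omega> !! (i - 1))) :: ennreal)" for a and \<omega> :: "(('a \<Rightarrow> 'a) \<times> real) stream"
    by (cases i) (auto simp: T0_def T1_def)
  let ?J = "\<lambda>z \<omega>. path_sum V (step_mat \<omega>) k z (\<lambda>l. f (x # l))"
  let ?E = "\<lambda>z. walk_mean V (trans_mat P) k z (\<lambda>l. f (x # l))"
  have Jnn: "0 \<le> ?J z \<omega>" if "z \<in> V" for z \<omega>
    using Suc.prems that by (intro path_sum_nonneg) (auto simp: step_mat_def)
  have Enn: "0 \<le> ?E z" if "z \<in> V" for z
    using Suc.prems that by (intro path_sum_nonneg) (auto simp: trans_mat_def)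
  have "(\<integral>\<^sup>+\<omega>. ennreal (path_sum V (step_mat \<omega>) (Suc k) x f) * indicator T (snd (\<omega> !! i)) \<partial>driving_measure V P) =
      (\<integral>\<^sup>+a. \<integral>\<^sup>+\<omega>. ennreal (path_sum V (step_mat (a ## \<omega>)) (Suc k) x f) *
         indicator T (snd ((a ## \<omega>) !! i)) \<partial>driving_measure V P \<partial>step_measure V P)"
  proof -
    have "(\<lambda>\<omega>. ennreal (path_sum V (step_mat \<omega>) (Suc k) x f) * indicator T (snd (\<omega> !! i)))
        \<in> borel_measurable (driving_measure V P)"
      using meas[of "Suc k" x f] by (intro borel_measurable_times_ennreal) measurable
    then show ?thesis
      unfolding driving_measure_eq by (rule S.nn_integral_stream_space)
  qed
  also have "\<dots> = (\<integral>\<^sup>+a. \<integral>\<^sup>+\<omega>. (\<Sum>z\<in>V. (indicator ({F. F x = z} \<times> T0) a) *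
      (ennreal (?J z \<omega>) * indicator T1 (snd (\<omega> !! (i - 1))))) \<partial>driving_measure V P \<partial>step_measure V P)"
  proof (intro nn_integral_cong)
    fix a :: "('a \<Rightarrow> 'a) \<times> real" and \<omega> :: "(('a \<Rightarrow> 'a) \<times> real) stream"
    have "ennreal (path_sum V (step_mat (a ## \<omega>)) (Suc k) x f) =
        (\<Sum>z\<in>V. ennreal (of_bool (fst a x = z)) * ennreal (?J z \<omega>))"
      unfolding path_sum_step_mat_Suc
      by (subst sum_ennreal[symmetric]) (auto simp: Jnn ennreal_mult)
    moreover have "indicator ({F. F x = z} \<times> T0) a = (ennreal (of_bool (fst a x = z)) * indicator T0 (snd a))" for z
      by (cases a) (auto simp: indicator_def)
    ultimately show "ennreal (path_sum V (step_mat (a ## \<omega>)) (Suc k) x f) * indicator T (snd ((a ## \<omega>) !! i)) =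
       (\<Sum>z\<in>V. (indicator ({F. F x = z} \<times> T0) a) * (ennreal (?J z \<omega>) * indicator T1 (snd (\<omega> !! (i - 1)))))"
      unfolding ind by (simp only: sum_distrib_right) (simp add: mult_ac)
  qed
  also have "\<dots> = (\<integral>\<^sup>+a. (\<Sum>z\<in>V. indicator ({F. F x = z} \<times> T0) a *
      (ennreal (?E z) * emeasure hold_measure T1)) \<partial>step_measure V P)"
    using Suc.IH Suc.prems by (simp add: nn_integral_sum nn_integral_cmult cong: sum.cong)
  also have "\<dots> = (\<Sum>z\<in>V. emeasure (step_measure V P) ({F. F x = z} \<times> T0) *
      (ennreal (?E z) * emeasure hold_measure T1))"
  proof -
    have "{F. F x = z} \<times> T0 \<in> sets (step_measure V P)" for z
      by (simp add: step_measure_def sets_hold_measure)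
    then show ?thesis
      by (simp add: nn_integral_sum nn_integral_multc)
  qed
  also have "\<dots> = (\<Sum>z\<in>V. ennreal (pmf (P x) z * ?E z)) * (emeasure hold_measure T0 * emeasure hold_measure T1)"
    using fin Suc.prems Enn
    by (simp add: emeasure_step_measure sum_distrib_left ennreal_mult mult_ac cong: sum.cong)
  also have "(\<Sum>z\<in>V. ennreal (pmf (P x) z * ?E z)) = ennreal (walk_mean V (trans_mat P) (Suc k) x f)"
    using Enn by (subst sum_ennreal) (auto simp: trans_mat_def)
  also have "emeasure hold_measure T0 * emeasure hold_measure T1 = emeasure hold_measure T"
    using prob_space.emeasure_space_1[OF prob_space_hold_measure]
    by (auto simp: T0_def T1_def hold_measure_def)
  finally show ?case .
qed

section \<open>From realised paths to the intersection time\<close>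

lemma jump_chain_Suc_shift:
  "jump_chain x \<omega> (Suc k) = jump_chain (fst (shd \<omega>) x) (stl \<omega>) k"
  by (induction k) simp_all

text \<open>Only the realised path has weight 1. The sum is 0 if that path moves outside
  \<open>V\<close>, so only an inequality holds; this is the direction a lower bound on the
  intersection time requires.\<close>

lemma path_sum_step_mat_le:
  assumes "finite V" "\<And>l. 0 \<le> f l"
  shows "path_sum V (step_mat \<omega>) k x f \<le> f (map (jump_chain x \<omega>) [0..<Suc k])"
  using assms(2)
proof (induction k arbitrary: x f \<omega>)
  case (Suc k)
  let ?y = "fst (shd \<omega>) x"
  have map_eq: "map (jump_chain x \<omega>) [0..<Suc (Suc k)] = x # map (jump_chain ?y (stl \<omega>)) [0..<Suc k]"
    by (subst upt_conv_Cons, simp)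
      (simp only: list.map map_Suc_upt[symmetric] map_map o_def jump_chain_Suc_shift jump_chain.simps(1))
  have "path_sum V (step_mat \<omega>) (Suc k) x f =
      (\<Sum>z\<in>V. of_bool (?y = z) * path_sum V (step_mat (stl \<omega>)) k z (\<lambda>l. f (x # l)))"
    using path_sum_step_mat_Suc[of V "shd \<omega>" "stl \<omega>" k x f] by simp
  also have "\<dots> = (\<Sum>z\<in>V. if z = ?y then path_sum V (step_mat (stl \<omega>)) k z (\<lambda>l. f (x # l)) else 0)"
    by (intro sum.cong) auto
  also have "\<dots> \<le> f (x # map (jump_chain ?y (stl \<omega>)) [0..<Suc k])"
    using assms(1) Suc.prems Suc.IH[of "\<lambda>l. f (x # l)" "stl \<omega>" ?y] by simp
  finally show ?case
    unfolding map_eq .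
qed simp

lemma ct_chain_in_jump_chain:
  assumes "0 \<le> t" "t < jump_time \<omega> m"
  shows "ct_chain x \<omega> t \<in> jump_chain x \<omega> ` {..<m}"
proof -
  obtain k where k: "m = Suc k"
    using assms by (cases m) (auto simp: jump_time_def)
  then have "(LEAST k. t < jump_time \<omega> (Suc k)) \<le> k"
    using assms by (intro Least_le) simp
  then show ?thesis
    by (auto simp: ct_chain_def k)
qed

lemma intersection_time_ge:
  assumes disj: "\<And>i j. i < m \<Longrightarrow> j < m \<Longrightarrow> jump_chain x \<omega> i \<noteq> jump_chain y \<omega>' j"
    and nn: "\<And>i. 0 \<le> snd (\<omega> !! i)" "\<And>i. 0 \<le> snd (\<omega>' !! i)"
  shows "(\<Sum>i<m. indicator {1<..} (snd (\<omega> !! i)) * indicator {1<..} (snd (\<omega>' !! i)) :: ennreal) \<le>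
    intersection_time (ct_chain x \<omega>) (ct_chain y \<omega>')"
proof -
  define s where "s = (\<Sum>i<m. of_bool (1 < snd (\<omega> !! i) \<and> 1 < snd (\<omega>' !! i)) :: real)"
  have s: "s \<le> jump_time \<omega> m" "s \<le> jump_time \<omega>' m"
    unfolding s_def jump_time_def
    by (rule sum_mono, use nn in \<open>auto simp: of_bool_def\<close>)+
  have "ennreal s \<le> intersection_time (ct_chain x \<omega>) (ct_chain y \<omega>')"
    unfolding intersection_time_def
  proof (rule Inf_greatest)
    fix r
    assume "r \<in> {ennreal t |t. 0 \<le> t \<and> (ct_chain x \<omega> t \<in> ct_chain y \<omega>' ` {0..t} \<or>
      ct_chain y \<omega>' t \<in> ct_chain x \<omega> ` {0..t})}"
    then obtain t where t: "r = ennreal t" "0 \<le> t"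
      "ct_chain x \<omega> t \<in> ct_chain y \<omega>' ` {0..t} \<or> ct_chain y \<omega>' t \<in> ct_chain x \<omega> ` {0..t}"
      by blast
    \<comment> \<open>The pair \<open>v\<close>, \<open>w\<close> is \<open>t\<close>,
      \<open>u\<close> in either order, which covers both alternatives in the intersection
      condition.\<close>
    have False if "t < s" "0 \<le> u" "u \<le> t" "v = t \<and> w = u \<or> v = u \<and> w = t"
      "ct_chain x \<omega> v = ct_chain y \<omega>' w" for u v w
    proof -
      have "0 \<le> v" "v < jump_time \<omega> m" "0 \<le> w" "w < jump_time \<omega>' m"
        using that s t(2) by auto
      then have "ct_chain x \<omega> v \<in> jump_chain x \<omega> ` {..<m}" "ct_chain y \<omega>' w \<in> jump_chain y \<omega>' ` {..<m}"
        using ct_chain_in_jump_chain by metis+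
      then show False
        using that(5) disj by (metis imageE lessThan_iff)
    qed
    from t(3) this[of _ t _] this[of _ _ t] have "s \<le> t"
      by force
    then show "ennreal s \<le> r"
      using t(1) by (simp add: ennreal_leI)
  qed
  moreover have "(\<Sum>i<m. indicator {1<..} (snd (\<omega> !! i)) * indicator {1<..} (snd (\<omega>' !! i)) :: ennreal) = ennreal s"
  proof -
    have "indicator {1<..} (snd (\<omega> !! i)) * indicator {1<..} (snd (\<omega>' !! i)) =
        ennreal (of_bool (1 < snd (\<omega> !! i) \<and> 1 < snd (\<omega>' !! i)))" for i
      by (simp add: indicator_def)
    then show ?thesis
      unfolding s_def by (simp only:) (rule sum_ennreal, simp)
  qed
  ultimately show ?thesis
    by simp
qed

lemma AE_driving_measure: "AE \<omega> in driving_measure V P. \<forall>i. 0 \<le> snd (\<omega> !! i)"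
proof -
  interpret S: prob_space "step_measure V P"
    by (rule prob_space_step_measure)
  interpret H: prob_space hold_measure
    by (rule prob_space_hold_measure)
  interpret pair_prob_space "measure_pmf (Pi_pmf V undefined P)" hold_measure ..
  have "AE a in step_measure V P. 0 \<le> snd a"
    unfolding step_measure_def by (rule AE_pair_measure) (auto intro: AE_hold_measure)
  then have "AE \<omega> in stream_space (step_measure V P). stream_all (\<lambda>a. 0 \<le> snd a) \<omega>"
    by (rule S.AE_stream_all[rotated]) measurable
  then show ?thesis
    by (simp only: driving_measure_eq stream_all_def)
qed

text \<open>
  If the jump chains stay disjoint for \<open>m\<close> steps, the intersection time is at least the number of
  \<open>i < m\<close> for which both \<open>i\<close>-th holding times exceed 1. A product of indicators is used because it
  integrates separately over the two chains.
\<close>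

lemma expected_intersection_time_ge:
  assumes fin: "finite V" and xy: "x \<in> V" "y \<in> V"
  shows "ennreal (real m * exp (- 2) * walk_mean V (trans_mat P) (m + m) x (\<lambda>l.
      walk_mean V (trans_mat P) m y (\<lambda>l'. of_bool (\<not> (\<exists>i\<le>m. l ! i \<in> set l')))))
    \<le> expected_intersection_time V P x y"
proof -
  let ?D = "driving_measure V P"
  let ?p = "trans_mat P"
  interpret D: prob_space ?D
    by (rule prob_space_driving_measure)
  interpret pair_prob_space ?D ?D ..
  define F where "F l l' = (of_bool (\<not> (\<exists>i\<le>m. l ! i \<in> set l')) :: real)" for l l' :: "'a list"
  let ?T = "{1<..} :: real set"
  let ?Y = "\<lambda>\<omega>' l. path_sum V (step_mat \<omega>') m y (F l)"
  \<comment> \<open>A measurable minorant of the indicator that the two realised jump paths avoid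
    each other.\<close>
  define g where "g \<omega> \<omega>' = path_sum V (step_mat \<omega>) (m + m) x (?Y \<omega>')" for \<omega> \<omega>'
  have step_nn: "0 \<le> step_mat \<omega> i u v" for \<omega> :: "(('a \<Rightarrow> 'a) \<times> real) stream" and i u v
    by (simp add: step_mat_def)
  have p_nn: "0 \<le> ?p u v" for u v
    by (simp add: trans_mat_def)
  have F_nn: "0 \<le> F l l'" for l l'
    by (simp add: F_def)
  have Y_nn: "0 \<le> ?Y \<omega>' l" for \<omega>' l
    using xy(2) by (intro path_sum_nonneg step_nn F_nn)
  have g_nn: "0 \<le> g \<omega> \<omega>'" for \<omega> \<omega>'
    unfolding g_def using xy(1) by (intro path_sum_nonneg step_nn Y_nn)
  have g_meas [measurable]: "(\<lambda>\<omega>. g (fst \<omega>) (snd \<omega>)) \<in> borel_measurable (?D \<Otimes>\<^sub>M ?D)"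
    unfolding g_def
    by (intro measurable_path_sum measurable_compose[OF measurable_fst measurable_step_mat]
        measurable_compose[OF measurable_snd measurable_step_mat]) simp
  have [measurable]: "(\<lambda>\<omega>. path_sum V (step_mat \<omega>) k z f) \<in> borel_measurable ?D" for k z f
    by (rule measurable_path_sum) measurable
  have [measurable]: "(\<lambda>\<omega>. snd (fst \<omega> !! i)) \<in> borel_measurable (?D \<Otimes>\<^sub>M ?D)"
    "(\<lambda>\<omega>. snd (snd \<omega> !! i)) \<in> borel_measurable (?D \<Otimes>\<^sub>M ?D)" for i
    by (intro measurable_compose[OF measurable_fst measurable_snd_driving]
        measurable_compose[OF measurable_snd measurable_snd_driving])+
  have pointwise: "(\<Sum>i<m. ennreal (g \<omega> \<omega>') * indicator ?T (snd (\<omega> !! i)) * indicator ?T (snd (\<omega>' !! i)))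
      \<le> intersection_time (ct_chain x \<omega>) (ct_chain y \<omega>')"
    if nn: "\<And>i. 0 \<le> snd (\<omega> !! i)" "\<And>i. 0 \<le> snd (\<omega>' !! i)" for \<omega> \<omega>'
  proof -
    let ?l = "map (jump_chain x \<omega>) [0..<Suc (m + m)]"
    let ?l' = "map (jump_chain y \<omega>') [0..<Suc m]"
    have "g \<omega> \<omega>' \<le> ?Y \<omega>' ?l"
      unfolding g_def by (intro path_sum_step_mat_le fin Y_nn)
    also have "\<dots> \<le> F ?l ?l'"
      by (intro path_sum_step_mat_le fin F_nn)
    finally have le: "g \<omega> \<omega>' \<le> F ?l ?l'" .
    show ?thesis
    proof (cases "\<exists>i\<le>m. ?l ! i \<in> set ?l'")
      case True
      then have "g \<omega> \<omega>' = 0"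
        using le g_nn[of \<omega> \<omega>'] by (simp add: F_def)
      then show ?thesis
        by simp
    next
      case False
      have "jump_chain x \<omega> i \<noteq> jump_chain y \<omega>' j" if "i < m" "j < m" for i j
      proof
        assume "jump_chain x \<omega> i = jump_chain y \<omega>' j"
        moreover have "?l ! i = jump_chain x \<omega> i"
          using that by (subst nth_map) (auto simp del: upt_Suc)
        ultimately have "?l ! i \<in> set ?l'"
          using that by (auto simp del: upt_Suc)
        then show False
          using False that by (meson less_imp_le)
      qed
      then have *: "(\<Sum>i<m. indicator ?T (snd (\<omega> !! i)) * indicator ?T (snd (\<omega>' !! i))) \<le>
          intersection_time (ct_chain x \<omega>) (ct_chain y \<omega>')"
        using nn by (rule intersection_time_ge)
      have "F l l' \<le> 1" for l l'
        by (simp add: F_def)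
      then have "ennreal (g \<omega> \<omega>') \<le> 1"
        using le order_trans by fastforce
      then have "(\<Sum>i<m. ennreal (g \<omega> \<omega>') * indicator ?T (snd (\<omega> !! i)) * indicator ?T (snd (\<omega>' !! i))) \<le>
          (\<Sum>i<m. 1 * indicator ?T (snd (\<omega> !! i)) * indicator ?T (snd (\<omega>' !! i)))"
        by (intro sum_mono mult_right_mono) auto
      then show ?thesis
        using * by (simp add: order.trans)
    qed
  qed
  let ?W = "walk_mean V ?p (m + m) x (\<lambda>l. walk_mean V ?p m y (F l))"
  have integral: "(\<integral>\<^sup>+\<omega>. ennreal (g (fst \<omega>) (snd \<omega>)) * indicator ?T (snd (fst \<omega> !! i)) *
      indicator ?T (snd (snd \<omega> !! i)) \<partial>(?D \<Otimes>\<^sub>M ?D)) = ennreal (exp (- 2) * ?W)" for i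
  proof -
    have W_nn: "0 \<le> walk_mean V ?p m y f" if "\<And>l. 0 \<le> f l" for f
      using xy(2) that by (intro path_sum_nonneg p_nn)
    \<comment> \<open>Swapping the two path sums puts the path of \<open>\<omega>'\<close> outside,
      so its integral can be taken while \<open>\<omega>\<close> is frozen.\<close>
    have inner: "(\<integral>\<^sup>+\<omega>'. ennreal (g \<omega> \<omega>') * indicator ?T (snd (\<omega>' !! i)) \<partial>?D) =
        ennreal (path_sum V (step_mat \<omega>) (m + m) x (\<lambda>l. walk_mean V ?p m y (F l))) * ennreal (exp (- 1))" for \<omega>
    proof -
      have "0 \<le> path_sum V (step_mat \<omega>) (m + m) x (\<lambda>l. F l l')" for l'
        using xy(1) by (intro path_sum_nonneg step_nn F_nn)
      then have "(\<integral>\<^sup>+\<omega>'. ennreal (path_sum V (step_mat \<omega>') m y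
            (\<lambda>l'. path_sum V (step_mat \<omega>) (m + m) x (\<lambda>l. F l l'))) * indicator ?T (snd (\<omega>' !! i)) \<partial>?D) =
          ennreal (walk_mean V ?p m y (\<lambda>l'. path_sum V (step_mat \<omega>) (m + m) x (\<lambda>l. F l l'))) * ennreal (exp (- 1))"
        by (subst nn_integral_path_sum[OF fin xy(2)]) (simp_all add: emeasure_hold_measure_gt_1)
      then show ?thesis
        unfolding g_def by (simp add: path_sum_swap[of V "step_mat \<omega>"])
    qed
    have "(\<integral>\<^sup>+\<omega>. ennreal (g (fst \<omega>) (snd \<omega>)) * indicator ?T (snd (fst \<omega> !! i)) *
        indicator ?T (snd (snd \<omega> !! i)) \<partial>(?D \<Otimes>\<^sub>M ?D)) =
      (\<integral>\<^sup>+\<omega>. \<integral>\<^sup>+\<omega>'. ennreal (g \<omega> \<omega>') * indicator ?T (snd (\<omega> !! i)) * indicator ?T (snd (\<omega>' !! i)) \<partial>?D \<partial>?D)"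
      by (subst D.nn_integral_fst[symmetric]) simp_all
    also have "\<dots> = (\<integral>\<^sup>+\<omega>. indicator ?T (snd (\<omega> !! i)) *
        (\<integral>\<^sup>+\<omega>'. ennreal (g \<omega> \<omega>') * indicator ?T (snd (\<omega>' !! i)) \<partial>?D) \<partial>?D)"
    proof (intro nn_integral_cong)
      fix \<omega>
      assume "\<omega> \<in> space ?D"
      then have [measurable]: "g \<omega> \<in> borel_measurable ?D"
        using measurable_Pair2[OF g_meas] by simp
      show "(\<integral>\<^sup>+\<omega>'. ennreal (g \<omega> \<omega>') * indicator ?T (snd (\<omega> !! i)) * indicator ?T (snd (\<omega>' !! i)) \<partial>?D) =
          indicator ?T (snd (\<omega> !! i)) * (\<integral>\<^sup>+\<omega>'. ennreal (g \<omega> \<omega>') * indicator ?T (snd (\<omega>' !! i)) \<partial>?D)"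
        by (subst nn_integral_cmult[symmetric]) (simp_all add: mult_ac)
    qed
    also have "\<dots> = (\<integral>\<^sup>+\<omega>. ennreal (exp (- 1)) * (ennreal (path_sum V (step_mat \<omega>) (m + m) x
        (\<lambda>l. walk_mean V ?p m y (F l))) * indicator ?T (snd (\<omega> !! i))) \<partial>?D)"
      by (simp add: inner mult_ac)
    also have "\<dots> = ennreal (exp (- 1)) * (ennreal ?W * ennreal (exp (- 1)))"
      by (subst nn_integral_cmult, measurable)
        (subst nn_integral_path_sum[OF fin xy(1)], simp_all add: W_nn F_nn emeasure_hold_measure_gt_1)
    also have "\<dots> = ennreal (exp (- 2) * ?W)"
    proof -
      have "0 \<le> ?W"
        using xy(1) by (intro path_sum_nonneg p_nn W_nn F_nn)
      moreover have "exp (- 2) = exp (- 1) * exp (- 1 :: real)"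
        by (simp add: exp_add[symmetric])
      ultimately show ?thesis
        by (simp add: ennreal_mult mult_ac)
    qed
    finally show ?thesis .
  qed
  have "ennreal (real m * exp (- 2) * ?W) = (\<Sum>i<m. ennreal (exp (- 2) * ?W))"
    by (simp add: ennreal_mult'' ennreal_of_nat_eq_real_of_nat mult.assoc) (simp add: ennreal_mult')
  also have "\<dots> = (\<integral>\<^sup>+\<omega>. (\<Sum>i<m. ennreal (g (fst \<omega>) (snd \<omega>)) * indicator ?T (snd (fst \<omega> !! i)) *
      indicator ?T (snd (snd \<omega> !! i))) \<partial>(?D \<Otimes>\<^sub>M ?D))"
    by (subst nn_integral_sum) (simp_all add: integral)
  \<comment> \<open>Monotonicity of the nonnegative integral asks for no measurability of the
    intersection time; the pointwise bound holds where all holding times are nonnegative.\<close>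
  also have "\<dots> \<le> expected_intersection_time V P x y"
    unfolding expected_intersection_time_def
  proof (rule nn_integral_mono_AE)
    have "AE \<omega> in ?D \<Otimes>\<^sub>M ?D. (\<forall>i. 0 \<le> snd (fst \<omega> !! i)) \<and> (\<forall>i. 0 \<le> snd (snd \<omega> !! i))"
    proof (rule AE_pair_measure)
      show "{\<omega> \<in> space (?D \<Otimes>\<^sub>M ?D). (\<forall>i. 0 \<le> snd (fst \<omega> !! i)) \<and> (\<forall>i. 0 \<le> snd (snd \<omega> !! i))} \<in> sets (?D \<Otimes>\<^sub>M ?D)"
        by measurable
      show "AE \<omega> in ?D. AE \<omega>' in ?D. (\<forall>i. 0 \<le> snd (fst (\<omega>, \<omega>') !! i)) \<and> (\<forall>i. 0 \<le> snd (snd (\<omega>, \<omega>') !! i))"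
        using AE_driving_measure[of V P] by (auto elim: eventually_mono)
    qed
    then show "AE \<omega> in ?D \<Otimes>\<^sub>M ?D. (\<Sum>i<m. ennreal (g (fst \<omega>) (snd \<omega>)) *
        indicator ?T (snd (fst \<omega> !! i)) * indicator ?T (snd (snd \<omega> !! i))) \<le>
        intersection_time (ct_chain x (fst \<omega>)) (ct_chain y (snd \<omega>))"
      by eventually_elim (rule pointwise, auto)
  qed
  finally show ?thesis
    unfolding F_def .
qed

section \<open>Transitive reversible chains\<close>

lemma mat_power_eigenbasis:
  assumes eig: "\<And>j x. j < n \<Longrightarrow> x \<in> V \<Longrightarrow> mat_vec V A (\<phi> j) x = c j * \<phi> j x"
    and complete: "\<And>x y. x \<in> V \<Longrightarrow> y \<in> V \<Longrightarrow> (\<Sum>j<n. \<phi> j x * \<phi> j y) = id_mat x y"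
    and "x \<in> V" "y \<in> V"
  shows "mat_power V A k x y = (\<Sum>j<n. c j ^ k * (\<phi> j x * \<phi> j y))"
  using assms(3)
proof (induction k arbitrary: x)
  case 0
  then show ?case
    using complete assms(4) by simp
next
  case (Suc k)
  have "mat_power V A (Suc k) x y = (\<Sum>z\<in>V. \<Sum>j<n. A x z * (c j ^ k * (\<phi> j z * \<phi> j y)))"
    using Suc.IH by (simp add: sum_distrib_left cong: sum.cong)
  also have "\<dots> = (\<Sum>j<n. \<Sum>z\<in>V. A x z * (c j ^ k * (\<phi> j z * \<phi> j y)))"
    by (rule sum.swap)
  also have "\<dots> = (\<Sum>j<n. c j ^ k * \<phi> j y * mat_vec V A (\<phi> j) x)"
    by (simp add: mat_vec_def sum_distrib_left mult_ac)
  also have "\<dots> = (\<Sum>j<n. c j ^ Suc k * (\<phi> j x * \<phi> j y))"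
    using eig Suc.prems by (intro sum.cong) auto
  finally show ?case .
qed

lemma mat_exp_eigenbasis:
  assumes eig: "\<And>j x. j < n \<Longrightarrow> x \<in> V \<Longrightarrow> mat_vec V A (\<phi> j) x = c j * \<phi> j x"
    and complete: "\<And>x y. x \<in> V \<Longrightarrow> y \<in> V \<Longrightarrow> (\<Sum>j<n. \<phi> j x * \<phi> j y) = id_mat x y"
    and "x \<in> V" "y \<in> V"
  shows "mat_exp V A x y = (\<Sum>j<n. exp (c j) * (\<phi> j x * \<phi> j y))"
proof -
  have "(\<lambda>k. \<Sum>j<n. c j ^ k /\<^sub>R fact k * (\<phi> j x * \<phi> j y)) sums
      (\<Sum>j<n. exp (c j) * (\<phi> j x * \<phi> j y))"
    by (intro sums_sum sums_mult2 exp_converges)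
  moreover have "(\<Sum>j<n. c j ^ k /\<^sub>R fact k * (\<phi> j x * \<phi> j y)) = mat_power V A k x y / fact k" for k
    using mat_power_eigenbasis[where \<phi> = \<phi> and c = c, OF eig complete assms(3,4)]
    by (simp add: divide_inverse sum_distrib_left mult_ac)
  ultimately show ?thesis
    unfolding mat_exp_def by (simp add: sums_iff)
qed

lemma mat_power_automorphism:
  assumes bij: "bij_betw f V V"
    and f: "\<And>x y. x \<in> V \<Longrightarrow> y \<in> V \<Longrightarrow> A x y = A (f x) (f y)"
    and "x \<in> V" "y \<in> V"
  shows "mat_power V A k (f x) (f y) = mat_power V A k x y"
  using assms(3)
proof (induction k arbitrary: x)
  case 0
  then show ?case
    using bij assms(4) by (auto simp: id_mat_def bij_betw_def inj_on_eq_iff)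
next
  case (Suc k)
  have "mat_power V A (Suc k) (f x) (f y) = (\<Sum>z\<in>V. A (f x) (f z) * mat_power V A k (f z) (f y))"
    using sum.reindex_bij_betw[OF bij, of "\<lambda>z. A (f x) z * mat_power V A k z (f y)"] by simp
  also have "\<dots> = mat_power V A (Suc k) x y"
    using Suc f by (auto intro!: sum.cong)
  finally show ?case .
qed

lemma stochastic_on_trans_mat:
  assumes "finite V" "transition_kernel V P"
  shows "stochastic_on V (trans_mat P)"
  using assms by (auto simp: stochastic_on_def trans_mat_def transition_kernel_def intro!: sum_pmf_eq_1)

section \<open>Uniformity of the stationary distribution and symmetry\<close>

locale transitive_reversible_chain =
  fixes V :: "'a set" and P :: "'a \<Rightarrow> 'a pmf" and \<pi> :: "'a pmf"
  assumes fin: "finite V" and card2: "card V \<ge> 2"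
    and kernel: "transition_kernel V P" and irr: "irreducible_chain V P"
    and stat: "stationary_distribution V P \<pi>" and rev: "reversible_chain V P \<pi>"
    and trans: "transitive_chain V P"
begin

abbreviation "p \<equiv> trans_mat P"
abbreviation "n \<equiv> card V"

lemma stoch: "stochastic_on V p"
  using fin kernel by (rule stochastic_on_trans_mat)

lemma p_nonneg: "0 \<le> p x y"
  by (simp add: trans_mat_def)

lemma p_row: "x \<in> V \<Longrightarrow> (\<Sum>y\<in>V. p x y) = 1"
  using stoch by (simp add: stochastic_on_def)

lemma nonempty: "V \<noteq> {}"
  using card2 by auto

lemma n_pos: "0 < real n"
  using card2 by simp

lemma mat_power_nonneg: "0 \<le> mat_power V p k x y"
  by (induction k arbitrary: x) (auto simp: id_mat_def p_nonneg intro!: sum_nonneg mult_nonneg_nonneg)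

text \<open>Irreducibility as an induction rule: a positive entry of a matrix power unfolds into a
  path of positive steps.\<close>

lemma reachable_induct:
  assumes "x \<in> V" "y \<in> V" "R x"
    and step: "\<And>u v. u \<in> V \<Longrightarrow> v \<in> V \<Longrightarrow> R u \<Longrightarrow> 0 < p u v \<Longrightarrow> R v"
  shows "R y"
proof -
  obtain k where "0 < mat_power V p k x y"
    using irr assms(1,2) by (auto simp: irreducible_chain_def)
  then show ?thesis
    using assms(1,3)
  proof (induction k arbitrary: x)
    case 0
    then show ?case
      by (simp add: id_mat_def split: if_splits)
  next
    case (Suc k)
    have "\<exists>z\<in>V. p x z * mat_power V p k z y > 0"
    proof (rule ccontr)
      assume "\<not> ?thesis"
      then have "(\<Sum>z\<in>V. p x z * mat_power V p k z y) \<le> 0"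
        by (intro sum_nonpos) (auto simp: not_less)
      then show False
        using Suc.prems by simp
    qed
    then obtain z where z: "z \<in> V" "0 < p x z" "0 < mat_power V p k z y"
      using p_nonneg mat_power_nonneg by (metis zero_less_mult_iff not_less)
    then show ?case
      using Suc step by blast
  qed
qed

text \<open>Maximum principle: where \<open>h\<close> is maximal, averaging forces the maximum on
  every neighbour.\<close>

lemma harmonic_constant:
  assumes h: "\<And>x. x \<in> V \<Longrightarrow> (\<Sum>y\<in>V. p x y * h y) = h x" and "x \<in> V" "y \<in> V"
  shows "h x = h y"
proof -
  define M where "M = Max (h ` V)"
  have le: "h y \<le> M" if "y \<in> V" for y
    using that fin by (simp add: M_def)
  have "M \<in> h ` V"
    using fin nonempty by (simp add: M_def)
  then obtain x0 where x0: "x0 \<in> V" "h x0 = M"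
    by auto
  have "h y = M" if "y \<in> V" for y
    using x0(1) that x0(2)
  proof (rule reachable_induct)
    fix u v
    assume uv: "u \<in> V" "v \<in> V" "h u = M" "0 < p u v"
    have "(\<Sum>z\<in>V. p u z * (M - h z)) = 0"
      using uv h[of u] p_row[of u] by (simp add: right_diff_distrib sum_subtractf sum_distrib_right[symmetric])
    then have "p u v * (M - h v) = 0"
      using uv(2) fin le p_nonneg by (subst (asm) sum_nonneg_eq_0_iff) auto
    then show "h v = M"
      using uv(4) by simp
  qed
  then show ?thesis
    using assms by simp
qed

lemma automorphism:
  assumes "x \<in> V" "y \<in> V"
  obtains f where "bij_betw f V V" "f x = y"
    "\<And>w z. w \<in> V \<Longrightarrow> z \<in> V \<Longrightarrow> p w z = p (f w) (f z)"
  using trans assms unfolding transitive_chain_def by blast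

text \<open>Automorphisms carry any column onto any other, so all column sums agree, and their
  average is that of the row sums.\<close>

lemma p_column: "y \<in> V \<Longrightarrow> (\<Sum>x\<in>V. p x y) = 1"
proof -
  assume y: "y \<in> V"
  have "(\<Sum>x\<in>V. p x z) = (\<Sum>x\<in>V. p x y)" if z: "z \<in> V" for z
  proof -
    obtain f where f: "bij_betw f V V" "f y = z"
      "\<And>w z. w \<in> V \<Longrightarrow> z \<in> V \<Longrightarrow> p w z = p (f w) (f z)"
      using automorphism[OF y z] by blast
    have "(\<Sum>x\<in>V. p x z) = (\<Sum>x\<in>V. p (f x) (f y))"
      using sum.reindex_bij_betw[OF f(1), of "\<lambda>x. p x z"] f(2) by simp
    also have "\<dots> = (\<Sum>x\<in>V. p x y)"
      by (rule sum.cong) (auto simp: f(3)[symmetric] y)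
    finally show ?thesis .
  qed
  then have "real n * (\<Sum>x\<in>V. p x y) = (\<Sum>z\<in>V. \<Sum>x\<in>V. p x z)"
    by simp
  also have "\<dots> = (\<Sum>x\<in>V. \<Sum>z\<in>V. p x z)"
    by (rule sum.swap)
  also have "\<dots> = real n"
    by (simp add: p_row)
  finally show ?thesis
    using n_pos by simp
qed

text \<open>Detailed balance turns \<open>\<Sum>v. p u v / \<pi> v\<close> into
  \<open>1 / \<pi> u\<close> times a column sum, so \<open>1 / \<pi>\<close> is harmonic and hence
  constant. Positivity of \<open>\<pi>\<close> first spreads along edges by the same
  balance.\<close>

lemma pi_uniform:
  assumes "x \<in> V"
  shows "pmf \<pi> x = 1 / real n"
proof -
  have sub: "set_pmf \<pi> \<subseteq> V"
    using stat by (simp add: stationary_distribution_def)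
  have rev: "pmf \<pi> x * p x y = pmf \<pi> y * p y x" if "x \<in> V" "y \<in> V" for x y
    using rev that by (simp add: reversible_chain_def)
  obtain x0 where x0: "x0 \<in> set_pmf \<pi>"
    using set_pmf_not_empty[of \<pi>] by blast
  have pos: "0 < pmf \<pi> y" if "y \<in> V" for y
  proof (rule reachable_induct[of x0])
    show "x0 \<in> V" "y \<in> V" "0 < pmf \<pi> x0"
      using x0 sub that by (auto simp: pmf_positive)
    fix u v
    assume "u \<in> V" "v \<in> V" "0 < pmf \<pi> u" "0 < p u v"
    then have "0 < pmf \<pi> v * p v u"
      unfolding rev[OF \<open>u \<in> V\<close> \<open>v \<in> V\<close>, symmetric] by simp
    then show "0 < pmf \<pi> v"
      using pmf_nonneg[of \<pi> v] by (cases "pmf \<pi> v = 0") auto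
  qed
  have "1 / pmf \<pi> y = 1 / pmf \<pi> x" if "y \<in> V" for y
  proof (rule harmonic_constant[OF _ that assms])
    fix u assume u: "u \<in> V"
    have "p u v * (1 / pmf \<pi> v) = p v u * (1 / pmf \<pi> u)" if "v \<in> V" for v
      using rev[OF u that] pos[OF u] pos[OF that] by (simp add: field_simps)
    then have "(\<Sum>v\<in>V. p u v * (1 / pmf \<pi> v)) = (\<Sum>v\<in>V. p v u * (1 / pmf \<pi> u))"
      by simp
    also have "\<dots> = 1 / pmf \<pi> u"
      using p_column[OF u] by (simp add: sum_divide_distrib[symmetric])
    finally show "(\<Sum>v\<in>V. p u v * (1 / pmf \<pi> v)) = 1 / pmf \<pi> u" .
  qed
  then have eq: "pmf \<pi> y = pmf \<pi> x" if "y \<in> V" for y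
    using that by (metis div_by_1 divide_divide_eq_right mult_1)
  have "(\<Sum>y\<in>V. pmf \<pi> y) = (\<Sum>y\<in>V. pmf \<pi> x)"
    by (rule sum.cong[OF refl eq])
  then show ?thesis
    using sum_pmf_eq_1[OF fin sub] n_pos by (simp add: field_simps)
qed

lemma p_symmetric: "x \<in> V \<Longrightarrow> y \<in> V \<Longrightarrow> p x y = p y x"
  using rev[unfolded reversible_chain_def, rule_format, of x y] pi_uniform[of x] pi_uniform[of y] n_pos
  by simp

lemma laplacian_symmetric: "x \<in> V \<Longrightarrow> y \<in> V \<Longrightarrow> laplacian P x y = laplacian P y x"
  using p_symmetric by (simp add: laplacian_def id_mat_def)

lemma mat_vec_laplacian: "x \<in> V \<Longrightarrow> mat_vec V (laplacian P) f x = f x - mat_vec V p f x"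
  using fin by (simp add: mat_vec_def laplacian_def left_diff_distrib sum_subtractf sum_id_mat)

lemma green_automorphism:
  assumes "bij_betw f V V" "\<And>w z. w \<in> V \<Longrightarrow> z \<in> V \<Longrightarrow> p w z = p (f w) (f z)" "x \<in> V" "y \<in> V"
  shows "green V p k (f x) (f y) = green V p k x y"
  unfolding green_def using mat_power_automorphism[of f V p x y, OF assms] by simp

lemma green_sq_constant:
  assumes "x \<in> V" "y \<in> V"
  shows "green_sq V p m x = green_sq V p m y"
proof -
  obtain f where f: "bij_betw f V V" "f x = y"
    "\<And>w z. w \<in> V \<Longrightarrow> z \<in> V \<Longrightarrow> p w z = p (f w) (f z)"
    using automorphism[OF assms] by blast
  have "green_sq V p m y = (\<Sum>z\<in>V. (green V p m (f x) (f z))\<^sup>2)"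
    unfolding green_sq_def using sum.reindex_bij_betw[OF f(1), of "\<lambda>z. (green V p m y z)\<^sup>2"] f(2) by simp
  also have "\<dots> = green_sq V p m x"
    unfolding green_sq_def using green_automorphism[OF f(1,3) assms(1)] by simp
  finally show ?thesis ..
qed

lemma heat_kernel_diag_constant:
  assumes "x \<in> V" "y \<in> V"
  shows "heat_kernel V P t x x = heat_kernel V P t y y"
proof -
  obtain f where f: "bij_betw f V V" "f x = y"
    "\<And>w z. w \<in> V \<Longrightarrow> z \<in> V \<Longrightarrow> p w z = p (f w) (f z)"
    using automorphism[OF assms] by blast
  have "- t * laplacian P u v = - t * laplacian P (f u) (f v)" if "u \<in> V" "v \<in> V" for u v
    using f(1) that f(3)[OF that] by (auto simp: laplacian_def id_mat_def bij_betw_def inj_on_eq_iff)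
  from mat_power_automorphism[of f V "\<lambda>u v. - t * laplacian P u v" x x, OF f(1) this assms(1) assms(1)] show ?thesis
    by (simp add: heat_kernel_def mat_exp_def f(2))
qed

end

section \<open>Relaxation time, mixing time and intersection time\<close>

text \<open>The fourth power of \<open>x/4 \<le> exp (x/4)\<close>;
  \<open>256 = 4^4\<close>.\<close>

lemma exp_neg_le:
  assumes "0 < (x::real)"
  shows "exp (- x) \<le> 256 / x ^ 4"
proof -
  have "(x / 4) ^ 4 \<le> exp (x / 4) ^ 4"
  proof (rule power_mono)
    show "x / 4 \<le> exp (x / 4)"
      using exp_ge_add_one_self[of "x / 4"] by linarith
  qed (use assms in simp)
  also have "\<dots> = exp x"
    by (simp add: exp_of_nat_mult[symmetric])
  finally show ?thesis
    using assms by (simp add: exp_minus field_simps power_divide)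
qed

text \<open>The constant vector sits at index 0, so \<open>{1..<n}\<close> indexes the nonzero
  eigenvalues with multiplicity. No order is imposed on \<open>lam\<close>.\<close>

locale chain_eigenbasis = transitive_reversible_chain +
  fixes \<phi> :: "nat \<Rightarrow> 'a \<Rightarrow> real" and lam :: "nat \<Rightarrow> real"
  assumes phi_0: "\<phi> 0 = (\<lambda>_. 1 / sqrt (real n))" and lam_0: "lam 0 = 0"
    and orthonormal: "orthonormal_upto V n \<phi>"
    and eigen: "\<And>j x. j < n \<Longrightarrow> x \<in> V \<Longrightarrow> mat_vec V (laplacian P) (\<phi> j) x = lam j * \<phi> j x"
    and complete: "\<And>x y. x \<in> V \<Longrightarrow> y \<in> V \<Longrightarrow> (\<Sum>j<n. \<phi> j x * \<phi> j y) = id_mat x y"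

lemma (in transitive_reversible_chain) ex_chain_eigenbasis: "\<exists>\<phi> lam. chain_eigenbasis V P \<pi> \<phi> lam"
proof -
  let ?u = "\<lambda>_::'a. 1 / sqrt (real n)"
  have 1: "inner_on V ?u ?u = 1"
    using n_pos by (simp add: inner_on_def)
  have 2: "mat_vec V (laplacian P) ?u x = 0 * ?u x" if "x \<in> V" for x
    using p_row[OF that]
    by (simp add: mat_vec_laplacian that) (simp add: mat_vec_def sum_divide_distrib[symmetric])
  show ?thesis
  proof (rule orthonormal_eigenbasis[of V "laplacian P" ?u 0, OF fin laplacian_symmetric 1 2])
    fix \<phi> lam
    assume *: "\<phi> 0 = ?u" "lam 0 = 0" "orthonormal_upto V n \<phi>"
      "\<And>j x. j < n \<Longrightarrow> x \<in> V \<Longrightarrow> mat_vec V (laplacian P) (\<phi> j) x = lam j * \<phi> j x"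
      "\<And>x y. x \<in> V \<Longrightarrow> y \<in> V \<Longrightarrow> (\<Sum>j<n. \<phi> j x * \<phi> j y) = id_mat x y"
    have "chain_eigenbasis_axioms V P \<phi> lam"
      by (rule chain_eigenbasis_axioms.intro) (rule *; assumption)+
    then have "chain_eigenbasis V P \<pi> \<phi> lam"
      by (intro chain_eigenbasis.intro transitive_reversible_chain_axioms)
    then show ?thesis
      by blast
  qed
qed

context chain_eigenbasis
begin

section \<open>Spectrum of the Laplacian\<close>

lemma inner_phi: "i < n \<Longrightarrow> j < n \<Longrightarrow> inner_on V (\<phi> i) (\<phi> j) = (if i = j then 1 else 0)"
  using orthonormal by (simp add: orthonormal_upto_def)

lemma sum_phi_sq: "j < n \<Longrightarrow> (\<Sum>x\<in>V. (\<phi> j x)\<^sup>2) = 1"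
  using inner_phi[of j j] by (simp add: inner_on_def power2_eq_square)

lemma eigen_p: "j < n \<Longrightarrow> x \<in> V \<Longrightarrow> mat_vec V p (\<phi> j) x = (1 - lam j) * \<phi> j x"
  using eigen mat_vec_laplacian[of x "\<phi> j"] by (simp add: left_diff_distrib)

lemma phi_max:
  assumes "j < n"
  obtains x where "x \<in> V" "\<phi> j x \<noteq> 0" "\<And>y. y \<in> V \<Longrightarrow> \<bar>\<phi> j y\<bar> \<le> \<bar>\<phi> j x\<bar>"
proof -
  have "Max ((\<lambda>x. \<bar>\<phi> j x\<bar>) ` V) \<in> (\<lambda>x. \<bar>\<phi> j x\<bar>) ` V"
    using fin nonempty by (intro Max_in) auto
  then obtain x where x: "x \<in> V" "\<bar>\<phi> j x\<bar> = Max ((\<lambda>x. \<bar>\<phi> j x\<bar>) ` V)"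
    by auto
  have le: "\<bar>\<phi> j y\<bar> \<le> \<bar>\<phi> j x\<bar>" if "y \<in> V" for y
    unfolding x(2) using that fin by (intro Max_ge) auto
  moreover have "\<phi> j x \<noteq> 0"
  proof
    assume "\<phi> j x = 0"
    then have "(\<Sum>x\<in>V. (\<phi> j x)\<^sup>2) = 0"
      using le by (intro sum.neutral) auto
    then show False
      using sum_phi_sq[OF assms] by simp
  qed
  ultimately show thesis
    using that x(1) by blast
qed

text \<open>Averaging with \<open>p\<close> cannot increase the maximum modulus; evaluate the
  eigenvalue equation where \<open>\<phi> j\<close> is largest.\<close>

lemma abs_eigenvalue_le:
  assumes "j < n"
  shows "\<bar>1 - lam j\<bar> \<le> 1"
proof -
  obtain x where x: "x \<in> V" "\<phi> j x \<noteq> 0" "\<And>y. y \<in> V \<Longrightarrow> \<bar>\<phi> j y\<bar> \<le> \<bar>\<phi> j x\<bar>"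
    using phi_max[OF assms] by blast
  have "\<bar>1 - lam j\<bar> * \<bar>\<phi> j x\<bar> = \<bar>\<Sum>y\<in>V. p x y * \<phi> j y\<bar>"
    using eigen_p[OF assms x(1)] by (simp add: abs_mult[symmetric] mat_vec_def)
  also have "\<dots> \<le> (\<Sum>y\<in>V. p x y * \<bar>\<phi> j x\<bar>)"
    using x(3) p_nonneg
    by (intro order_trans[OF sum_abs] sum_mono) (simp add: abs_mult mult_left_mono)
  also have "\<dots> = \<bar>\<phi> j x\<bar>"
    using p_row[OF x(1)] by (simp add: sum_distrib_right[symmetric])
  finally show ?thesis
    using x(2) by simp
qed

text \<open>Otherwise \<open>\<phi> j\<close> would be harmonic, hence a nonzero constant, yet
  orthogonal to the constant vector \<open>\<phi> 0\<close>.\<close>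

lemma lam_nonzero:
  assumes "j < n" "j \<noteq> 0"
  shows "lam j \<noteq> 0"
proof
  assume "lam j = 0"
  then have harmonic: "(\<Sum>y\<in>V. p x y * \<phi> j y) = \<phi> j x" if "x \<in> V" for x
    using eigen_p[OF assms(1) that] by (simp add: mat_vec_def)
  obtain x where x: "x \<in> V" "\<phi> j x \<noteq> 0"
    using phi_max[OF assms(1)] by blast
  have "(\<Sum>y\<in>V. \<phi> j y) = (\<Sum>y\<in>V. \<phi> j x)"
    by (rule sum.cong[OF refl harmonic_constant[OF harmonic _ x(1)]])
  then have "(\<Sum>y\<in>V. \<phi> j y) = real n * \<phi> j x"
    by simp
  moreover have "(\<Sum>y\<in>V. \<phi> j y) = 0"
    using inner_phi[of 0 j] assms n_pos by (simp add: inner_on_def phi_0 sum_divide_distrib[symmetric])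
  ultimately show False
    using x(2) n_pos by simp
qed

lemma lam_pos: "j \<in> {1..<n} \<Longrightarrow> 0 < lam j"
  using lam_nonzero[of j] abs_eigenvalue_le[of j] by auto

lemma lam_le_2: "j < n \<Longrightarrow> lam j \<le> 2"
  using abs_eigenvalue_le[of j] by auto

lemma expansion:
  assumes "x \<in> V"
  shows "f x = (\<Sum>j<n. \<phi> j x * inner_on V (\<phi> j) f)"
proof -
  have "f x = (\<Sum>y\<in>V. (\<Sum>j<n. \<phi> j x * \<phi> j y) * f y)"
    using sum_id_mat[OF fin assms, of f] complete[OF assms] by simp
  also have "\<dots> = (\<Sum>j<n. \<Sum>y\<in>V. \<phi> j x * \<phi> j y * f y)"
    by (subst sum.swap) (simp add: sum_distrib_right)
  finally show ?thesis
    by (simp add: inner_on_def sum_distrib_left mult.assoc)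
qed

text \<open>An eigenvector has a nonzero inner product with some \<open>\<phi> j\<close>, and
  self-adjointness then forces the two eigenvalues to agree. The \<open>Min\<close> in
  \<open>lambda2\<close> is thereby taken over a finite nonempty set.\<close>

lemma nonzero_eigenvalues: "{c. mat_eigenvalue V (laplacian P) c \<and> c \<noteq> 0} = lam ` {1..<n}"
proof (intro equalityI subsetI)
  fix c
  assume "c \<in> {c. mat_eigenvalue V (laplacian P) c \<and> c \<noteq> 0}"
  then obtain f x where f: "x \<in> V" "f x \<noteq> 0" "c \<noteq> 0"
    "\<And>x. x \<in> V \<Longrightarrow> mat_vec V (laplacian P) f x = c * f x"
    by (auto simp: mat_eigenvalue_def mat_vec_def)
  have "\<exists>j<n. inner_on V (\<phi> j) f \<noteq> 0"
  proof (rule ccontr)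
    assume "\<not> ?thesis"
    then show False
      using expansion[OF f(1), of f] f(2) by simp
  qed
  then obtain j where j: "j < n" "inner_on V (\<phi> j) f \<noteq> 0"
    by blast
  have "lam j * inner_on V (\<phi> j) f = inner_on V (mat_vec V (laplacian P) (\<phi> j)) f"
    unfolding inner_on_scale[symmetric] using eigen[OF j(1)] by (intro inner_on_cong) auto
  also have "\<dots> = inner_on V (\<phi> j) (mat_vec V (laplacian P) f)"
    by (rule inner_on_mat_vec_symmetric[OF laplacian_symmetric])
  also have "\<dots> = inner_on V (\<phi> j) (\<lambda>x. c * f x)"
    using f(4) by (intro inner_on_cong) auto
  also have "\<dots> = c * inner_on V (\<phi> j) f"
    by (simp add: inner_on_commute[of V "\<phi> j"] inner_on_scale)
  finally have "lam j = c"
    using j(2) by simp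
  moreover have "j \<noteq> 0"
    using \<open>lam j = c\<close> f(3) lam_0 by metis
  ultimately show "c \<in> lam ` {1..<n}"
    using j(1) by force
next
  fix c
  assume "c \<in> lam ` {1..<n}"
  then obtain j where j: "c = lam j" "j \<in> {1..<n}"
    by auto
  then have "c \<noteq> 0"
    using lam_pos by force
  moreover obtain x where "x \<in> V" "\<phi> j x \<noteq> 0"
    using phi_max[of j] j(2) by auto
  ultimately show "c \<in> {c. mat_eigenvalue V (laplacian P) c \<and> c \<noteq> 0}"
    using eigen[of j] j by (auto simp: mat_eigenvalue_def mat_vec_def intro!: exI[of _ "\<phi> j"])
qed

lemma lambda2_eq: "lambda2 V P = Min (lam ` {1..<n})"
  by (simp add: lambda2_def nonzero_eigenvalues)

lemma lambda2_le: "j \<in> {1..<n} \<Longrightarrow> lambda2 V P \<le> lam j"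
  by (simp add: lambda2_eq)

lemma lambda2_attained: obtains j where "j \<in> {1..<n}" "lambda2 V P = lam j"
proof -
  have "lambda2 V P \<in> lam ` {1..<n}"
    unfolding lambda2_eq using card2 by (intro Min_in) auto
  then show thesis
    using that by blast
qed

lemma lambda2_pos: "0 < lambda2 V P"
  using lambda2_attained lam_pos by metis

lemma t_rel_pos: "0 < t_rel V P"
  using lambda2_pos by (simp add: t_rel_def)

lemma t_rel_ge_half: "1 / 2 \<le> t_rel V P"
proof -
  obtain j where "j \<in> {1..<n}" "lambda2 V P = lam j"
    by (rule lambda2_attained)
  then have "lambda2 V P \<le> 2"
    using lam_le_2 by simp
  then show ?thesis
    using lambda2_pos by (simp add: t_rel_def field_simps)
qed

lemma inverse_lam_le: "j \<in> {1..<n} \<Longrightarrow> 1 / lam j \<le> t_rel V P"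
  using lambda2_le[of j] lambda2_pos by (simp add: t_rel_def frac_le)

section \<open>Deviation of the heat kernel from equilibrium\<close>

lemma heat_kernel_eq:
  assumes "x \<in> V" "y \<in> V"
  shows "heat_kernel V P t x y = (\<Sum>j<n. exp (- t * lam j) * (\<phi> j x * \<phi> j y))"
  unfolding heat_kernel_def
proof (rule mat_exp_eigenbasis[OF _ complete assms])
  fix j x
  assume j: "j < n" "x \<in> V"
  have "mat_vec V (\<lambda>x y. - t * laplacian P x y) (\<phi> j) x = - t * mat_vec V (laplacian P) (\<phi> j) x"
    by (simp add: mat_vec_def sum_distrib_left mult.assoc)
  then show "mat_vec V (\<lambda>x y. - t * laplacian P x y) (\<phi> j) x = - t * lam j * \<phi> j x"
    using eigen[OF j] by simp
qed

lemma sum_split_0: "(\<Sum>j<n. g j) = g 0 + (\<Sum>j\<in>{1..<n}. g j)"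
proof -
  have "{..<n} = insert 0 {1..<n}"
    using card2 by auto
  then show ?thesis
    by simp
qed

lemma heat_kernel_minus_1:
  assumes "x \<in> V" "y \<in> V"
  shows "heat_kernel V P t x y / pmf \<pi> y - 1 = real n * (\<Sum>j\<in>{1..<n}. exp (- t * lam j) * (\<phi> j x * \<phi> j y))"
proof -
  have "real n * (exp (- t * lam 0) * (\<phi> 0 x * \<phi> 0 y)) = 1"
    using n_pos by (simp add: lam_0 phi_0)
  moreover have "(a + b) / (1 / real n) - 1 = real n * b" if "real n * a = 1" for a b
    using that by (simp add: distrib_right mult.commute)
  ultimately show ?thesis
    unfolding heat_kernel_eq[OF assms] pi_uniform[OF assms(2)] sum_split_0 by blast
qed

text \<open>\<open>tr H_t - 1\<close>: the eigenvalue 0 is left out.\<close>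

definition excess_trace :: "real \<Rightarrow> real" where
  "excess_trace t = (\<Sum>j\<in>{1..<n}. exp (- t * lam j))"

text \<open>Transitivity makes the diagonal constant, so each entry equals the average, which is a
  trace.\<close>

lemma heat_kernel_diag:
  assumes "x \<in> V"
  shows "real n * (\<Sum>j\<in>{1..<n}. exp (- t * lam j) * (\<phi> j x)\<^sup>2) = excess_trace t"
proof -
  let ?h = "\<lambda>x. \<Sum>j\<in>{1..<n}. exp (- t * lam j) * (\<phi> j x)\<^sup>2"
  have h: "real n * ?h y = heat_kernel V P t y y * real n - 1" if "y \<in> V" for y
    using heat_kernel_minus_1[OF that that] pi_uniform[OF that] by (simp add: power2_eq_square)
  have const: "?h y = ?h x" if "y \<in> V" for y
  proof -
    have "real n * ?h y = real n * ?h x"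
      unfolding h[OF that] h[OF assms] heat_kernel_diag_constant[OF that assms] ..
    then show ?thesis
      using n_pos by (simp only: mult_cancel_left) simp
  qed
  have "(\<Sum>y\<in>V. ?h x) = (\<Sum>y\<in>V. ?h y)"
    by (rule sum.cong[OF refl const[symmetric]])
  then have "real n * ?h x = (\<Sum>y\<in>V. ?h y)"
    by simp
  also have "\<dots> = (\<Sum>j\<in>{1..<n}. exp (- t * lam j) * (\<Sum>y\<in>V. (\<phi> j y)\<^sup>2))"
    by (subst sum.swap) (simp add: sum_distrib_left)
  also have "\<dots> = excess_trace t"
    unfolding excess_trace_def by (intro sum.cong) (simp_all add: sum_phi_sq)
  finally show ?thesis .
qed

text \<open>\<open>\<bar>ab\<bar> \<le> (a^2 + b^2)/2\<close> in each eigendirection bounds an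
  off-diagonal deviation by the mean of two diagonal ones.\<close>

lemma heat_kernel_deviation_le:
  assumes "x \<in> V" "y \<in> V"
  shows "\<bar>heat_kernel V P t x y / pmf \<pi> y - 1\<bar> \<le> excess_trace t"
proof -
  have "\<bar>heat_kernel V P t x y / pmf \<pi> y - 1\<bar> =
      real n * \<bar>\<Sum>j\<in>{1..<n}. exp (- t * lam j) * (\<phi> j x * \<phi> j y)\<bar>"
    unfolding heat_kernel_minus_1[OF assms] by (simp add: abs_mult)
  also have "\<dots> \<le> real n * (\<Sum>j\<in>{1..<n}. exp (- t * lam j) * (((\<phi> j x)\<^sup>2 + (\<phi> j y)\<^sup>2) / 2))"
  proof (intro mult_left_mono order_trans[OF sum_abs] sum_mono)
    fix j
    have "\<bar>\<phi> j x * \<phi> j y\<bar> \<le> ((\<phi> j x)\<^sup>2 + (\<phi> j y)\<^sup>2) / 2"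
      using sum_squares_bound[of "\<bar>\<phi> j x\<bar>" "\<bar>\<phi> j y\<bar>"] by (simp add: abs_mult)
    then show "\<bar>exp (- t * lam j) * (\<phi> j x * \<phi> j y)\<bar> \<le> exp (- t * lam j) * (((\<phi> j x)\<^sup>2 + (\<phi> j y)\<^sup>2) / 2)"
      by (subst abs_mult) (simp add: mult_left_mono)
  qed simp
  also have "\<dots> = (real n * (\<Sum>j\<in>{1..<n}. exp (- t * lam j) * (\<phi> j x)\<^sup>2) +
      real n * (\<Sum>j\<in>{1..<n}. exp (- t * lam j) * (\<phi> j y)\<^sup>2)) / 2"
    unfolding sum_distrib_left sum.distrib[symmetric] sum_divide_distrib
    by (intro sum.cong refl) (simp add: field_simps)
  also have "\<dots> = excess_trace t"
    unfolding heat_kernel_diag[OF assms(1)] heat_kernel_diag[OF assms(2)] by simp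
  finally show ?thesis .
qed

section \<open>Mixing time against relaxation time and \<open>Q\<close>\<close>

definition inverse_square_trace :: real where
  "inverse_square_trace = (\<Sum>j\<in>{1..<n}. 1 / (lam j)\<^sup>2)"

lemma inverse_square_trace_pos: "0 < inverse_square_trace"
  unfolding inverse_square_trace_def using card2 lam_pos by (intro sum_pos) force+

abbreviation "mixed_times \<equiv> {t. 0 \<le> t \<and>
  Max ((\<lambda>(a, b). \<bar>heat_kernel V P t a b / pmf \<pi> b - 1\<bar>) ` (V \<times> V)) \<le> 1 / 2}"

lemma mixed_times_iff:
  "t \<in> mixed_times \<longleftrightarrow> 0 \<le> t \<and> (\<forall>a\<in>V. \<forall>b\<in>V. \<bar>heat_kernel V P t a b / pmf \<pi> b - 1\<bar> \<le> 1 / 2)"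
  unfolding mem_Collect_eq using fin nonempty by (subst Max_le_iff) auto

text \<open>With \<open>R\<close> the relaxation time, \<open>t\<close> is chosen so that
  \<open>t^4 = 625 R^2 Q\<close>; the excess trace is then at most \<open>256/625 \<le> 1/2\<close>,
  and 5 is the least integer factor for which this works.\<close>

lemma mixed_time:
  defines "t \<equiv> 5 * sqrt (t_rel V P * sqrt inverse_square_trace)"
  shows "t \<in> mixed_times"
proof -
  let ?R = "t_rel V P" and ?Q = inverse_square_trace
  have pos: "0 < ?R * sqrt ?Q"
    using t_rel_pos inverse_square_trace_pos by simp
  then have t: "0 < t"
    by (simp add: t_def)
  have t2: "t ^ 2 = 25 * (?R * sqrt ?Q)"
    unfolding t_def power_mult_distrib using pos by simp
  have "t ^ 4 = (t ^ 2) ^ 2"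
    by (simp add: power_mult[symmetric])
  also have "\<dots> = 625 * (?R\<^sup>2 * ?Q)"
    unfolding t2 using inverse_square_trace_pos by (simp add: power_mult_distrib)
  finally have t4: "t ^ 4 = 625 * (?R\<^sup>2 * ?Q)" .
  have "excess_trace t \<le> (\<Sum>j\<in>{1..<n}. 256 / t ^ 4 * ?R\<^sup>2 * (1 / (lam j)\<^sup>2))"
    unfolding excess_trace_def
  proof (rule sum_mono)
    fix j
    assume j: "j \<in> {1..<n}"
    have "exp (- t * lam j) \<le> 256 / (t * lam j) ^ 4"
      using exp_neg_le[of "t * lam j"] t lam_pos[OF j] by simp
    also have "\<dots> = 256 / t ^ 4 * (1 / lam j)\<^sup>2 * (1 / (lam j)\<^sup>2)"
      by (simp add: power_mult_distrib power_divide power4_eq_xxxx power2_eq_square)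
    also have "\<dots> \<le> 256 / t ^ 4 * ?R\<^sup>2 * (1 / (lam j)\<^sup>2)"
      using inverse_lam_le[OF j] lam_pos[OF j] t
      by (intro mult_right_mono mult_left_mono power_mono) auto
    finally show "exp (- t * lam j) \<le> 256 / t ^ 4 * ?R\<^sup>2 * (1 / (lam j)\<^sup>2)" .
  qed
  also have "\<dots> = 256 / t ^ 4 * ?R\<^sup>2 * ?Q"
    by (simp add: inverse_square_trace_def sum_distrib_left)
  also have "\<dots> = 256 / 625"
    unfolding t4 using t_rel_pos inverse_square_trace_pos by simp
  finally have "excess_trace t \<le> 1 / 2"
    by simp
  then show ?thesis
    using heat_kernel_deviation_le t unfolding mixed_times_iff by (meson less_imp_le order_trans)
qed

lemma t_mix_inf_le: "t_mix_inf V P \<pi> \<le> 5 * sqrt (t_rel V P * sqrt inverse_square_trace)"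
  unfolding t_mix_inf_def by (rule cInf_lower[OF mixed_time]) (auto intro: bdd_belowI)

lemma t_mix_inf_nonneg: "0 \<le> t_mix_inf V P \<pi>"
proof -
  have "mixed_times \<noteq> {}"
    using mixed_time by blast
  then show ?thesis
    unfolding t_mix_inf_def by (rule cInf_greatest) simp
qed

lemma t_rel_le: "t_rel V P \<le> 2 * t_mix_inf V P \<pi>"
proof -
  have "t_rel V P / 2 \<le> t" if t: "t \<in> mixed_times" for t
  proof -
    obtain j where j: "j \<in> {1..<n}" "lambda2 V P = lam j"
      by (rule lambda2_attained)
    then have jn: "j < n"
      by simp
    obtain x where x: "x \<in> V" "\<phi> j x \<noteq> 0" "\<And>y. y \<in> V \<Longrightarrow> \<bar>\<phi> j y\<bar> \<le> \<bar>\<phi> j x\<bar>"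
      using phi_max[OF jn] by blast
    have orth: "(\<Sum>y\<in>V. \<phi> j y) = 0"
      using inner_phi[of 0 j] j n_pos by (simp add: inner_on_def phi_0 sum_divide_distrib[symmetric])
    have "(\<Sum>y\<in>V. heat_kernel V P t x y * \<phi> j y) =
        (\<Sum>y\<in>V. \<Sum>i<n. exp (- t * lam i) * \<phi> i x * (\<phi> i y * \<phi> j y))"
      by (simp add: heat_kernel_eq x(1) sum_distrib_right mult.assoc cong: sum.cong)
    also have "\<dots> = (\<Sum>i<n. exp (- t * lam i) * \<phi> i x * inner_on V (\<phi> i) (\<phi> j))"
      by (subst sum.swap) (simp add: inner_on_def sum_distrib_left)
    also have "\<dots> = (\<Sum>i<n. if i = j then exp (- t * lam j) * \<phi> j x else 0)"
      using inner_phi jn by (intro sum.cong) auto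
    also have "\<dots> = exp (- t * lam j) * \<phi> j x"
      using jn by simp
    finally have H: "(\<Sum>y\<in>V. heat_kernel V P t x y * \<phi> j y) = exp (- t * lam j) * \<phi> j x" .
    \<comment> \<open>Subtracting the equilibrium value is free because the eigenfunction has mean
      zero.\<close>
    have "exp (- t * lam j) * \<phi> j x = (\<Sum>y\<in>V. (heat_kernel V P t x y / pmf \<pi> y - 1) * (\<phi> j y / real n))"
    proof -
      have "(\<Sum>y\<in>V. (heat_kernel V P t x y / pmf \<pi> y - 1) * (\<phi> j y / real n)) =
          (\<Sum>y\<in>V. heat_kernel V P t x y * \<phi> j y - \<phi> j y / real n)"
        using n_pos by (intro sum.cong refl) (simp add: pi_uniform, simp add: field_simps)
      then show ?thesis
        using H orth by (simp add: sum_subtractf sum_divide_distrib[symmetric])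
    qed
    from this[symmetric]
    have "exp (- t * lam j) * \<bar>\<phi> j x\<bar> = \<bar>\<Sum>y\<in>V. (heat_kernel V P t x y / pmf \<pi> y - 1) * (\<phi> j y / real n)\<bar>"
      by (simp only: abs_mult abs_exp_cancel)
    also have "\<dots> \<le> (\<Sum>y\<in>V. 1 / 2 * (\<bar>\<phi> j x\<bar> / real n))"
    proof (intro order_trans[OF sum_abs] sum_mono)
      fix y
      assume y: "y \<in> V"
      have "\<bar>heat_kernel V P t x y / pmf \<pi> y - 1\<bar> \<le> 1 / 2"
        using t[unfolded mixed_times_iff] x(1) y by blast
      moreover have "\<bar>\<phi> j y / real n\<bar> \<le> \<bar>\<phi> j x\<bar> / real n"
        using x(3)[OF y] by (simp add: divide_right_mono)
      ultimately show "\<bar>(heat_kernel V P t x y / pmf \<pi> y - 1) * (\<phi> j y / real n)\<bar> \<le> 1 / 2 * (\<bar>\<phi> j x\<bar> / real n)"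
        unfolding abs_mult by (intro mult_mono) auto
    qed
    also have "\<dots> = 1 / 2 * \<bar>\<phi> j x\<bar>"
      using n_pos by simp
    finally have "exp (- t * lam j) \<le> 1 / 2"
      using x(2) by simp
    \<comment> \<open>From \<open>1 - x \<le> exp (- x)\<close>; this produces the constant 2 in
      place of \<open>1 / ln 2\<close>.\<close>
    then have "1 / 2 \<le> t * lam j"
      using exp_ge_add_one_self[of "- t * lam j"] by simp
    then show ?thesis
      using lambda2_pos j(2) by (simp add: t_rel_def field_simps)
  qed
  then have "t_rel V P / 2 \<le> t_mix_inf V P \<pi>"
    unfolding t_mix_inf_def using mixed_time by (intro cInf_greatest) blast+
  then show ?thesis
    by simp
qed

section \<open>Trace of the squared Green matrix\<close>

definition geom :: "nat \<Rightarrow> nat \<Rightarrow> real" where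
  "geom m j = (\<Sum>i\<le>m. (1 - lam j) ^ i)"

lemma green_eq:
  assumes "x \<in> V" "y \<in> V"
  shows "green V p m x y = (\<Sum>j<n. geom m j * (\<phi> j x * \<phi> j y))"
proof -
  have "green V p m x y = (\<Sum>i\<le>m. \<Sum>j<n. (1 - lam j) ^ i * (\<phi> j x * \<phi> j y))"
    unfolding green_def using mat_power_eigenbasis[where \<phi> = \<phi>, OF eigen_p complete assms] by simp
  also have "\<dots> = (\<Sum>j<n. \<Sum>i\<le>m. (1 - lam j) ^ i * (\<phi> j x * \<phi> j y))"
    by (rule sum.swap)
  finally show ?thesis
    by (simp add: geom_def sum_distrib_right)
qed

lemma green_symmetric: "x \<in> V \<Longrightarrow> y \<in> V \<Longrightarrow> green V p m x y = green V p m y x"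
  by (simp add: green_eq mult.commute)

text \<open>The Green matrix is symmetric with eigenvalues \<open>geom m j\<close>, so
  \<open>green_sq\<close> at \<open>z\<close> is a diagonal entry of its square. By transitivity all
  these entries agree, and \<open>n\<close> of them make up the trace.\<close>

lemma green_sq_trace:
  assumes "x \<in> V"
  shows "real n * green_sq V p m x = (\<Sum>j<n. (geom m j)\<^sup>2)"
proof -
  have sq: "green_sq V p m z = (\<Sum>j<n. (geom m j)\<^sup>2 * (\<phi> j z)\<^sup>2)" if z: "z \<in> V" for z
  proof -
    have "green_sq V p m z = inner_on V (\<lambda>y. \<Sum>j<n. geom m j * \<phi> j z * \<phi> j y) (green V p m z)"
      unfolding green_sq_def inner_on_def
      by (intro sum.cong refl) (simp add: power2_eq_square green_eq z mult.assoc)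
    also have "\<dots> = (\<Sum>j<n. geom m j * \<phi> j z * inner_on V (\<phi> j) (green V p m z))"
      by (simp only: inner_on_sum inner_on_scale)
    also have "\<dots> = (\<Sum>j<n. (geom m j)\<^sup>2 * (\<phi> j z)\<^sup>2)"
    proof (rule sum.cong)
      fix j
      assume "j \<in> {..<n}"
      then have j: "j < n"
        by simp
      have "inner_on V (\<phi> j) (green V p m z) = inner_on V (\<lambda>y. \<Sum>i<n. geom m i * \<phi> i z * \<phi> i y) (\<phi> j)"
        by (subst inner_on_commute, intro inner_on_cong) (simp_all add: green_eq z mult.assoc)
      also have "\<dots> = (\<Sum>i<n. geom m i * \<phi> i z * inner_on V (\<phi> i) (\<phi> j))"
        by (simp only: inner_on_sum inner_on_scale)
      also have "\<dots> = (\<Sum>i<n. if i = j then geom m j * \<phi> j z else 0)"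
        using inner_phi j by (intro sum.cong) auto
      finally have "inner_on V (\<phi> j) (green V p m z) = geom m j * \<phi> j z"
        using j by simp
      then show "geom m j * \<phi> j z * inner_on V (\<phi> j) (green V p m z) = (geom m j)\<^sup>2 * (\<phi> j z)\<^sup>2"
        by (simp add: power2_eq_square)
    qed simp
    finally show ?thesis .
  qed
  have "(\<Sum>z\<in>V. green_sq V p m x) = (\<Sum>z\<in>V. green_sq V p m z)"
    by (rule sum.cong[OF refl green_sq_constant[OF assms]])
  then have "real n * green_sq V p m x = (\<Sum>z\<in>V. green_sq V p m z)"
    by simp
  also have "\<dots> = (\<Sum>z\<in>V. \<Sum>j<n. (geom m j)\<^sup>2 * (\<phi> j z)\<^sup>2)"
    by (simp add: sq)
  also have "\<dots> = (\<Sum>j<n. (geom m j)\<^sup>2 * (\<Sum>z\<in>V. (\<phi> j z)\<^sup>2))"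
    by (subst sum.swap) (simp add: sum_distrib_left)
  finally show ?thesis
    by (simp add: sum_phi_sq)
qed

text \<open>The parity of \<open>m\<close> matters when \<open>1 - lam j\<close> is negative.\<close>

lemma geom_ge:
  assumes j: "j \<in> {1..<n}" and m: "even m" "t_rel V P \<le> real (Suc m)"
  shows "1 / (2 * lam j) \<le> geom m j"
proof -
  let ?mu = "1 - lam j"
  have lam: "0 < lam j"
    by (rule lam_pos[OF j])
  have "lam j * geom m j = 1 - ?mu ^ Suc m"
    using one_diff_power_eq[of ?mu "Suc m"] by (simp add: geom_def lessThan_Suc_atMost)
  moreover have "?mu ^ Suc m \<le> 1 / 2"
  proof (cases "0 \<le> ?mu")
    case True
    have "1 \<le> real (Suc m) * lam j"
      using order_trans[OF inverse_lam_le[OF j] m(2)] lam by (simp add: field_simps)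
    have "?mu ^ Suc m \<le> exp (- lam j) ^ Suc m"
      using True exp_ge_add_one_self[of "- lam j"] by (intro power_mono) auto
    also have "\<dots> = exp (- (real (Suc m) * lam j))"
      by (subst exp_of_nat_mult[symmetric]) simp
    also have "\<dots> \<le> exp (- 1)"
      using \<open>1 \<le> real (Suc m) * lam j\<close> by simp
    also have "\<dots> \<le> 1 / 2"
      using exp_ge_add_one_self[of "1::real"] by (simp add: exp_minus field_simps)
    finally show ?thesis .
  next
    \<comment> \<open>\<open>Suc m\<close> is odd, so the power of a negative number stays
      negative.\<close>
    case False
    then have "?mu ^ Suc m < 0"
      using m(1) by (subst power_less_zero_eq) auto
    then show ?thesis
      by simp
  qed
  ultimately have "1 / 2 \<le> lam j * geom m j"
    by simp
  then show ?thesis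
    using lam by (simp add: field_simps)
qed

lemma green_sq_ge:
  assumes "x \<in> V" "even m" "t_rel V P \<le> real (Suc m)"
  shows "inverse_square_trace / 4 \<le> real n * green_sq V p m x"
proof -
  have "inverse_square_trace / 4 = (\<Sum>j\<in>{1..<n}. (1 / (2 * lam j))\<^sup>2)"
    by (simp add: inverse_square_trace_def sum_divide_distrib power_divide power_mult_distrib mult.commute)
  also have "\<dots> \<le> (\<Sum>j\<in>{1..<n}. (geom m j)\<^sup>2)"
    using geom_ge[OF _ assms(2,3)] lam_pos by (intro sum_mono power_mono) (auto intro: less_imp_le)
  also have "\<dots> \<le> real n * green_sq V p m x"
    unfolding green_sq_trace[OF assms(1)] sum_split_0 by simp
  finally show ?thesis .
qed

text \<open>Since \<open>n S \<ge> Q/4\<close>, the hypothesis gives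
  \<open>16 (2m+1)^2 \<le> Q/8 \<le> n S / 2\<close>: averaged over the start of \<open>Y\<close>,
  the walks avoid each other with probability at least \<open>1/2\<close>. The factor
  \<open>1/18\<close> is this \<open>1/2\<close> times \<open>1/9 \<le> exp (- 2)\<close>, where
  \<open>exp (- 2)\<close> is the probability that two holding times both exceed 1.\<close>

lemma t_I_ge:
  assumes m: "even m" "t_rel V P \<le> real (Suc m)"
    and le: "64 * (2 * real m + 1)\<^sup>2 \<le> inverse_square_trace / 2"
  shows "ennreal (real m / 18) \<le> t_I V P"
proof (cases "t_I V P")
  case (real T)
  obtain x where x: "x \<in> V"
    using nonempty by blast
  let ?S = "green_sq V p m x"
  let ?W = "\<lambda>f y. walk_mean V p (m + m) x (\<lambda>l. walk_mean V p m y (f l))"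
  let ?I = "\<lambda>l l'. of_bool (\<exists>i\<le>m. l ! i \<in> set l') :: real"
  have nS: "inverse_square_trace / 4 \<le> real n * ?S"
    by (rule green_sq_ge[OF x m])
  then have "0 < real n * ?S"
    using inverse_square_trace_pos by linarith
  then have S: "0 < ?S"
    using n_pos zero_less_mult_pos by blast
  have W: "?W (\<lambda>l l'. of_bool (\<not> (\<exists>i\<le>m. l ! i \<in> set l'))) y = 1 - ?W ?I y" if "y \<in> V" for y
    by (simp only: of_bool_not_iff path_sum_diff walk_mean_const[OF stoch that] walk_mean_const[OF stoch x])
  have each: "real m * exp (- 2) * (1 - ?W ?I y) \<le> T" if y: "y \<in> V" for y
  proof -
    have "ennreal (real m * exp (- 2) * (1 - ?W ?I y)) \<le> expected_intersection_time V P x y"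
      using expected_intersection_time_ge[OF fin x y, of m P] unfolding W[OF y] .
    also have "\<dots> \<le> t_I V P"
      unfolding t_I_def using fin x y by (intro Max_ge) auto
    finally show ?thesis
      using real by (simp add: ennreal_le_iff)
  qed
  have "real n * (real m * exp (- 2) / 2) = real m * exp (- 2) * (real n - real n / 2)"
    by (simp add: algebra_simps)
  also have "\<dots> \<le> real m * exp (- 2) * (real n - (\<Sum>y\<in>V. ?W ?I y))"
  proof -
    have "(\<Sum>y\<in>V. ?W ?I y) \<le> 16 * (2 * real m + 1)\<^sup>2 / ?S"
      using green_sq_constant[OF _ x] S
      by (intro intersection_probability_le[OF fin stoch x]) (auto simp: green_symmetric)
    also have "\<dots> \<le> real n / 2"
      using le nS S by (simp add: divide_le_eq)
    finally show ?thesis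
      by (intro mult_left_mono diff_left_mono) auto
  qed
  also have "\<dots> = (\<Sum>y\<in>V. real m * exp (- 2) * (1 - ?W ?I y))"
    by (simp add: sum_distrib_left[symmetric] sum_subtractf)
  also have "\<dots> \<le> (\<Sum>y\<in>V. T)"
    using each by (rule sum_mono)
  also have "\<dots> = real n * T"
    by simp
  finally have "real m * exp (- 2) / 2 \<le> T"
    using n_pos by simp
  moreover have "1 / 9 \<le> exp (- 2 :: real)"
  proof -
    have "exp (1::real) ^ 2 \<le> 3 ^ 2"
      using exp_le by (intro power_mono) auto
    then have "exp (2::real) \<le> 9"
      by (simp add: exp_of_nat_mult[symmetric])
    then show ?thesis
      by (simp add: exp_minus field_simps)
  qed
  then have "real m * (1 / 9) / 2 \<le> real m * exp (- 2) / 2"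
    by (intro divide_right_mono mult_left_mono) auto
  ultimately show ?thesis
    using real by (simp add: ennreal_le_iff)
qed simp

lemma sqrt_inverse_square_trace_le:
  assumes "t_I V P = ennreal T" "0 \<le> T"
  shows "sqrt inverse_square_trace \<le> 1800 * (t_rel V P + T)"
proof (cases "sqrt inverse_square_trace \<le> 1000 * t_rel V P")
  case True
  then show ?thesis
    using assms(2) t_rel_pos by simp
next
  case False
  let ?q = "sqrt inverse_square_trace"
  \<comment> \<open>Even by construction and about \<open>?q / 50\<close>. Since
    \<open>t_rel \<ge> 1/2\<close>, the present case gives \<open>?q \<ge> 500\<close>, so rounding
    is negligible: \<open>2m + 1 \<le> ?q / 12\<close> with \<open>64/144 \<le> 1/2\<close>, and
    \<open>m + 1\<close> exceeds \<open>t_rel\<close>.\<close>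
  define m where "m = 2 * nat \<lfloor>?q / 100\<rfloor>"
  have q: "500 \<le> ?q"
    using False t_rel_ge_half by simp
  then have "0 \<le> \<lfloor>?q / 100\<rfloor>"
    using inverse_square_trace_pos by simp
  then have fl: "real_of_int \<lfloor>?q / 100\<rfloor> = real (nat \<lfloor>?q / 100\<rfloor>)"
    by simp
  have m: "?q / 50 - 2 \<le> real m" "real m \<le> ?q / 50"
    using fl floor_correct[of "?q / 100"] by (auto simp: m_def)
  have "(2 * real m + 1)\<^sup>2 \<le> (?q / 12)\<^sup>2"
    using m q by (intro power_mono) auto
  also have "\<dots> = inverse_square_trace / 144"
    using inverse_square_trace_pos by (simp add: power_divide)
  finally have "64 * (2 * real m + 1)\<^sup>2 \<le> inverse_square_trace / 2"
    using inverse_square_trace_pos by simp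
  moreover have "t_rel V P \<le> real (Suc m)"
    using m q False by simp
  ultimately have "ennreal (real m / 18) \<le> t_I V P"
    by (intro t_I_ge) (auto simp: m_def)
  then have "real m / 18 \<le> T"
    using assms by (simp add: ennreal_le_iff)
  then show ?thesis
    using m q t_rel_pos by simp
qed

lemma t_mix_inf_sq_le:
  assumes "t_I V P = ennreal T" "0 \<le> T"
  shows "(t_mix_inf V P \<pi>)\<^sup>2 \<le> 45000 * t_rel V P * (t_rel V P + T)"
proof -
  have "(t_mix_inf V P \<pi>)\<^sup>2 \<le> (5 * sqrt (t_rel V P * sqrt inverse_square_trace))\<^sup>2"
    using t_mix_inf_le t_mix_inf_nonneg by (rule power_mono)
  also have "\<dots> = 25 * t_rel V P * sqrt inverse_square_trace"
    using t_rel_pos inverse_square_trace_pos by (simp add: power_mult_distrib)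
  also have "\<dots> \<le> 25 * t_rel V P * (1800 * (t_rel V P + T))"
    using sqrt_inverse_square_trace_le[OF assms] t_rel_pos by (intro mult_left_mono) auto
  finally show ?thesis
    by (simp add: algebra_simps)
qed

end

context transitive_reversible_chain
begin

lemma relaxation_and_mixing_bounds:
  "0 < t_rel V P" "0 \<le> t_mix_inf V P \<pi>" "t_rel V P \<le> 2 * t_mix_inf V P \<pi>"
  "t_I V P = ennreal T \<Longrightarrow> 0 \<le> T \<Longrightarrow> (t_mix_inf V P \<pi>)\<^sup>2 \<le> 45000 * t_rel V P * (t_rel V P + T)"
proof -
  obtain \<phi> lam where "chain_eigenbasis V P \<pi> \<phi> lam"
    using ex_chain_eigenbasis by blast
  then interpret chain_eigenbasis V P \<pi> \<phi> lam .
  show "0 < t_rel V P"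
    by (rule t_rel_pos)
  show "0 \<le> t_mix_inf V P \<pi>"
    by (rule t_mix_inf_nonneg)
  show "t_rel V P \<le> 2 * t_mix_inf V P \<pi>"
    by (rule t_rel_le)
  show "(t_mix_inf V P \<pi>)\<^sup>2 \<le> 45000 * t_rel V P * (t_rel V P + T)"
    if "t_I V P = ennreal T" "0 \<le> T"
    using that by (rule t_mix_inf_sq_le)
qed

end

section \<open>Passage to sequences of chains\<close>

lemma much_less_iff:
  "much_less f g \<longleftrightarrow> (\<forall>e>0. eventually (\<lambda>n. f n / g n \<le> ennreal e) sequentially)"
proof
  assume L: "much_less f g"
  show "\<forall>e>0. eventually (\<lambda>n. f n / g n \<le> ennreal e) sequentially"
  proof (intro allI impI)
    fix e :: real
    assume "0 < e"
    then have "0 < ennreal e"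
      by simp
    with L have "eventually (\<lambda>n. f n / g n < ennreal e) sequentially"
      unfolding much_less_def by (rule order_tendstoD)
    then show "eventually (\<lambda>n. f n / g n \<le> ennreal e) sequentially"
      by eventually_elim (rule less_imp_le)
  qed
next
  assume R: "\<forall>e>0. eventually (\<lambda>n. f n / g n \<le> ennreal e) sequentially"
  show "much_less f g"
    unfolding much_less_def
  proof (rule order_tendstoI)
    fix a :: ennreal
    assume "0 < a"
    then obtain b where b: "0 < b" "b < a"
      using dense by blast
    then obtain e where e: "b = ennreal e" "0 \<le> e"
      by (cases b) auto
    then have "0 < e"
      using b(1) by simp
    with R have "eventually (\<lambda>n. f n / g n \<le> b) sequentially"
      unfolding e(1) by blast
    then show "eventually (\<lambda>n. f n / g n < a) sequentially"
      by eventually_elim (rule le_less_trans[OF _ b(2)])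
  qed simp
qed

theorem corollary1p5:
  fixes V :: "nat \<Rightarrow> 'a set" and P :: "nat \<Rightarrow> 'a \<Rightarrow> 'a pmf" and \<pi> :: "nat \<Rightarrow> 'a pmf"
  assumes "\<And>n. finite (V n)"
    and "\<And>n. card (V n) \<ge> 2"
    and "\<And>n. transition_kernel (V n) (P n)"
    and "\<And>n. irreducible_chain (V n) (P n)"
    and "\<And>n. stationary_distribution (V n) (P n) (\<pi> n)"
    and "\<And>n. reversible_chain (V n) (P n) (\<pi> n)"
    and "\<And>n. transitive_chain (V n) (P n)"
  shows "much_less (\<lambda>n. ennreal (t_rel (V n) (P n))) (\<lambda>n. t_I (V n) (P n)) \<longleftrightarrow>
         much_less (\<lambda>n. ennreal (t_mix_inf (V n) (P n) (\<pi> n))) (\<lambda>n. t_I (V n) (P n))"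
proof -
  have "transitive_reversible_chain (V n) (P n) (\<pi> n)" for n
    by (rule transitive_reversible_chain.intro) (rule assms)+
  note bounds = transitive_reversible_chain.relaxation_and_mixing_bounds[OF this]
  let ?R = "\<lambda>n. t_rel (V n) (P n)" and ?M = "\<lambda>n. t_mix_inf (V n) (P n) (\<pi> n)"
  let ?T = "\<lambda>n. t_I (V n) (P n)"
  show ?thesis
  proof
    assume L: "much_less (\<lambda>n. ennreal (?R n)) ?T"
    show "much_less (\<lambda>n. ennreal (?M n)) ?T"
      unfolding much_less_iff
    proof (intro allI impI)
      fix e :: real
      assume e: "0 < e"
      \<comment> \<open>From \<open>?R n \<le> d T \<le> T\<close> follows
        \<open>(?M n)^2 \<le> 45000 * d T * 2 T\<close>, which must not exceed
        \<open>(e T)^2\<close>; the minimum with 1 ensures \<open>d T \<le> T\<close>.\<close>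
      define d where "d = min 1 (e\<^sup>2 / 90000)"
      have d: "0 < d" "d \<le> 1" "90000 * d \<le> e\<^sup>2"
        using e by (auto simp: d_def)
      have "eventually (\<lambda>n. ennreal (?R n) / ?T n \<le> ennreal d) sequentially"
        using L d(1) unfolding much_less_iff by blast
      then show "eventually (\<lambda>n. ennreal (?M n) / ?T n \<le> ennreal e) sequentially"
      proof eventually_elim
        case (elim n)
        show ?case
        proof (cases "?T n")
          case (real T)
          \<comment> \<open>A positive number divided by 0 is \<open>\<top>\<close> in
            \<open>ennreal\<close>, which no finite bound allows.\<close>
          have "T \<noteq> 0"
          proof
            assume "T = 0"
            then have "ennreal (?R n) / ?T n = \<top>"
              using real bounds(1)[of n] by (simp add: ennreal_divide_zero)
            then show False
              using elim by (simp add: top_unique)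
          qed
          then have T: "0 < T"
            using real by simp
          have "ennreal (?R n / T) \<le> ennreal d"
            using elim real T bounds(1)[of n] by (simp add: divide_ennreal)
          then have R: "?R n \<le> d * T"
            using d(1) T by (simp add: ennreal_le_iff divide_le_eq)
          have "(?M n)\<^sup>2 \<le> 45000 * ?R n * (?R n + T)"
            using bounds(4)[of n T] real by simp
          also have "\<dots> \<le> 45000 * (d * T) * (1 * T + T)"
            using R bounds(1)[of n] T d order_trans[OF R mult_right_mono[OF d(2)]]
            by (intro mult_mono add_right_mono) auto
          also have "\<dots> = 90000 * d * T\<^sup>2"
            by (simp add: power2_eq_square)
          also have "\<dots> \<le> e\<^sup>2 * T\<^sup>2"
            using d(3) by (intro mult_right_mono) auto
          finally have "(?M n)\<^sup>2 \<le> (e * T)\<^sup>2"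
            by (simp add: power_mult_distrib)
          then have "?M n \<le> e * T"
            by (rule power2_le_imp_le) (use e T in simp)
          then have "ennreal (?M n / T) \<le> ennreal e"
            using T by (intro ennreal_leI) (simp add: divide_le_eq)
          then show ?thesis
            unfolding real(2) by (subst divide_ennreal) (use T bounds(2)[of n] in auto)
        next
          \<comment> \<open>Division by \<open>\<top>\<close> gives 0.\<close>
          case top
          then show ?thesis
            by simp
        qed
      qed
    qed
  next
    assume L: "much_less (\<lambda>n. ennreal (?M n)) ?T"
    show "much_less (\<lambda>n. ennreal (?R n)) ?T"
      unfolding much_less_iff
    proof (intro allI impI)
      fix e :: real
      assume e: "0 < e"
      then have "eventually (\<lambda>n. ennreal (?M n) / ?T n \<le> ennreal (e / 2)) sequentially"
        using L unfolding much_less_iff by (metis half_gt_zero)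
      then show "eventually (\<lambda>n. ennreal (?R n) / ?T n \<le> ennreal e) sequentially"
      proof eventually_elim
        case (elim n)
        have "ennreal (?R n) / ?T n \<le> ennreal (2 * ?M n) / ?T n"
          using bounds(3)[of n] by (intro divide_right_mono_ennreal ennreal_leI)
        also have "\<dots> = 2 * (ennreal (?M n) / ?T n)"
          using bounds(2)[of n] by (simp add: ennreal_mult ennreal_times_divide)
        also have "\<dots> \<le> 2 * ennreal (e / 2)"
          using elim by (rule mult_left_mono) simp
        also have "\<dots> = ennreal e"
          using e by (simp add: ennreal_mult[symmetric] flip: ennreal_numeral)
        finally show ?case .
      qed
    qed
  qed
qed

end
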